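(* There is a constant $\epsilon>0$ such that for infinitely many positive integers $g$, there exists a graph of girth $6$ that is embeddable on a surface of Euler genus $g$ but is not $(0,0,\lceil \epsilon g\rceil)$-colorable.
   Context: All graphs are finite and simple (no loops, no multiple edges). For integers $d_1,\ldots,d_k$, a graph $G$ is $(d_1,\ldots,d_k)$-colorable if each vertex can be assigned a color from $\{1,\ldots,k\}$ such that for each $i$, every vertex colored $i$ has at most $d_i$ neighbors colored $i$. A surface is a non-null compact connected 2-manifold without boundary. The Euler genus of a surface is $2h$ if it is the orientable surface obtained from the sphere by adding $h\ge 0$ handles, and $k$ if it is the non-orientable surface obtained from the sphere by adding $k\ge 1$ cross-caps. *)

theory Defs
  imports "HOL-Analysis.Analysis" "HOL-Library.Extended_Nat"
begin

section \<open>Finite simple graphs, girth, defective colourings\<close>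

definition simple_graph :: "'v set \<Rightarrow> 'v set set \<Rightarrow> bool" where
  "simple_graph V E \<longleftrightarrow> finite V \<and> (\<forall>e\<in>E. e \<subseteq> V \<and> card e = 2)"

definition is_cycle :: "'v set set \<Rightarrow> 'v list \<Rightarrow> bool" where
  "is_cycle E vs \<longleftrightarrow> 3 \<le> length vs \<and> distinct vs \<and>
     (\<forall>i<length vs. {vs ! i, vs ! (Suc i mod length vs)} \<in> E)"

text \<open>The girth of a forest is \<open>\<infinity>\<close>, the infimum of the empty set.\<close>

definition girth :: "'v set set \<Rightarrow> enat" where
  "girth E = (INF vs \<in> {vs. is_cycle E vs}. enat (length vs))"

text \<open>The colours are the positions \<open>0, \<dots>, k - 1\<close> of the list \<open>[d\<^sub>1, \<dots>, d\<^sub>k]\<close>.\<close>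

definition defective_colorable :: "'v set \<Rightarrow> 'v set set \<Rightarrow> int list \<Rightarrow> bool" where
  "defective_colorable V E ds \<longleftrightarrow>
     (\<exists>col :: 'v \<Rightarrow> nat. \<forall>v\<in>V. col v < length ds \<and>
        int (card {u\<in>V. {u, v} \<in> E \<and> col u = col v}) \<le> ds ! col v)"

section \<open>Surfaces and Euler genus\<close>

text \<open>Second countability is not listed: a compact locally Euclidean space is a finite union of
  open second countable subspaces.\<close>

definition surface :: "'a topology \<Rightarrow> bool" where
  "surface X \<longleftrightarrow> topspace X \<noteq> {} \<and> compact_space X \<and> connected_space X \<and> Hausdorff_space X \<and>
     (\<forall>x\<in>topspace X. \<exists>U. openin X U \<and> x \<in> U \<and>
        (\<exists>W :: (real^2) set. open W \<and> subtopology X U homeomorphic_space top_of_set W))"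

text \<open>Discs on the unit sphere of \<open>\<real>\<^sup>3\<close> are spherical caps, cut off by the planes
  \<open>p i \<bullet> x = c i\<close>. The homeomorphism type of the spaces built below depends only on
  the number of caps, not on their positions and sizes.\<close>

definition disjoint_caps :: "nat \<Rightarrow> (nat \<Rightarrow> real^3) \<Rightarrow> (nat \<Rightarrow> real) \<Rightarrow> bool" where
  "disjoint_caps n p c \<longleftrightarrow>
     (\<forall>i<n. norm (p i) = 1 \<and> -1 < c i \<and> c i < 1) \<and>
     (\<forall>i<n. \<forall>j<n. i \<noteq> j \<longrightarrow>
        {x \<in> sphere 0 1. c i \<le> p i \<bullet> x} \<inter> {x \<in> sphere 0 1. c j \<le> p j \<bullet> x} = {})"

definition holed_sphere :: "nat \<Rightarrow> (nat \<Rightarrow> real^3) \<Rightarrow> (nat \<Rightarrow> real) \<Rightarrow> (real^3) set" where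
  "holed_sphere n p c = sphere 0 1 - (\<Union>i<n. {x. c i < p i \<bullet> x})"

definition rim :: "real^3 \<Rightarrow> real \<Rightarrow> (real^3) set" where
  "rim a t = {x \<in> sphere 0 1. a \<bullet> x = t}"

text \<open>Cross-cap: remove an open disc and identify antipodal points of its boundary circle.
  The circle \<open>rim (p i) (c i)\<close> has centre \<open>c i *\<^sub>R p i\<close>, so the antipode of \<open>x\<close> on it is
  \<open>2 * c i *\<^sub>R p i - x\<close>. The space \<open>X\<close> is described as a quotient of the holed sphere whose
  fibres are exactly the classes of this identification.\<close>

definition sphere_with_crosscaps :: "nat \<Rightarrow> 'a topology \<Rightarrow> bool" where
  "sphere_with_crosscaps k X \<longleftrightarrow>
     (\<exists>p c f. disjoint_caps k p c \<and>
        quotient_map (top_of_set (holed_sphere k p c)) X f \<and>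
        (\<forall>x\<in>holed_sphere k p c. \<forall>y\<in>holed_sphere k p c.
           f x = f y \<longleftrightarrow> x = y \<or> (\<exists>i<k. x \<in> rim (p i) (c i) \<and> y = (2 * c i) *\<^sub>R p i - x)))"

text \<open>The orthogonal reflection exchanging two distinct unit vectors \<open>a\<close> and \<open>b\<close>.\<close>

definition swap_reflection :: "real^3 \<Rightarrow> real^3 \<Rightarrow> real^3 \<Rightarrow> real^3" where
  "swap_reflection a b x = x - (2 * ((a - b) \<bullet> x) / ((a - b) \<bullet> (a - b))) *\<^sub>R (a - b)"

text \<open>Handle: remove two open discs (here the caps \<open>2 * i\<close> and \<open>2 * i + 1\<close>, of equal size) and
  identify their boundary circles. A reflection of the sphere reverses its orientation and takes
  the outer side of one circle to the outer side of the other, so identifying along it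
  yields an orientable surface (identifying along a rotation would give a Klein bottle handle).\<close>

definition sphere_with_handles :: "nat \<Rightarrow> 'a topology \<Rightarrow> bool" where
  "sphere_with_handles h X \<longleftrightarrow>
     (\<exists>p c f. disjoint_caps (2 * h) p c \<and> (\<forall>i<h. c (2 * i) = c (2 * i + 1)) \<and>
        quotient_map (top_of_set (holed_sphere (2 * h) p c)) X f \<and>
        (\<forall>x\<in>holed_sphere (2 * h) p c. \<forall>y\<in>holed_sphere (2 * h) p c.
           f x = f y \<longleftrightarrow> x = y \<or>
             (\<exists>i<h. (x \<in> rim (p (2 * i)) (c (2 * i)) \<and>
                       y = swap_reflection (p (2 * i)) (p (2 * i + 1)) x) \<or>
                    (y \<in> rim (p (2 * i)) (c (2 * i)) \<and>
                       x = swap_reflection (p (2 * i)) (p (2 * i + 1)) y))))"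

definition has_euler_genus :: "'a topology \<Rightarrow> nat \<Rightarrow> bool" where
  "has_euler_genus X g \<longleftrightarrow>
     (\<exists>h. g = 2 * h \<and> sphere_with_handles h X) \<or> (1 \<le> g \<and> sphere_with_crosscaps g X)"

section \<open>Embeddings of graphs\<close>

text \<open>Vertices are distinct points, edges are arcs joining their end vertices, and an
  interior point of an arc is neither a vertex nor on another arc.\<close>

definition embeds_in :: "'v set \<Rightarrow> 'v set set \<Rightarrow> 'a topology \<Rightarrow> bool" where
  "embeds_in V E X \<longleftrightarrow>
     (\<exists>(\<phi> :: 'v \<Rightarrow> 'a) (\<gamma> :: 'v set \<Rightarrow> real \<Rightarrow> 'a).
        \<phi> ` V \<subseteq> topspace X \<and> inj_on \<phi> V \<and>
        (\<forall>e\<in>E. pathin X (\<gamma> e) \<and> inj_on (\<gamma> e) {0..1} \<and> {\<gamma> e 0, \<gamma> e 1} = \<phi> ` e \<and>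
               \<gamma> e ` {0<..<1} \<inter> \<phi> ` V = {}) \<and>
        (\<forall>e\<in>E. \<forall>e'\<in>E. e \<noteq> e' \<longrightarrow> \<gamma> e ` {0<..<1} \<inter> \<gamma> e' ` {0<..<1} = {}))"

text \<open>Every surface has the cardinality of the continuum, so each one has a homeomorphic copy
  whose points are elements of \<open>real^3\<close> (with an arbitrary topology, not the subspace topology).\<close>

definition embeddable_with_euler_genus :: "'v set \<Rightarrow> 'v set set \<Rightarrow> nat \<Rightarrow> bool" where
  "embeddable_with_euler_genus V E g \<longleftrightarrow>
     (\<exists>X :: (real^3) topology. surface X \<and> has_euler_genus X g \<and> embeds_in V E X)"

end

(* Take seven disjoint 7-cycles (hubs). Two independent colour classes never cover a 7-cycle, so each of them
   contains a vertex of the third, defective colour. For every choice s of one vertex from each hub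
   cycle, attach N further 7-cycles (gadgets), the k-th gadget vertex being joined to the k-th chosen
   hub. When s selects hubs of the defective colour, each of the N gadgets contains a vertex of that
   colour, hence an edge from it to a hub of the same colour; so one of seven hubs has defect at
   least N/7. The girth is 6, since a cycle through a gadget and a hub uses at least two
   gadget segments, and each of these passes between different hub cycles along at least two gadget
   vertices.

   The number of edges is linear in N, so it suffices to embed a graph with M edges in the sphere
   with M handles. Put the 2M caps on the equator and the vertices on the circle through the
   northernmost points of the caps, with the caps at the ends of the edges of v listed right after v.
   Project orthogonally to the equatorial plane: each half edge becomes a chord from its vertex to the
   top of its cap, and these chords do not cross. The reflection that glues two caps is in a vertical
   plane, so it identifies the tops of the caps, which joins the two halves of an edge. *)

theory Submission
  imports Defs
begin

section \<open>The sphere with handles as a quotient space\<close>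

text \<open>The quotient topology is put on the image of \<open>f\<close>, so a space arises from a
  gluing map alone, with points of the type in which \<open>f\<close> takes its values.\<close>

lemma quotient_topology_exists:
  obtains X' where "quotient_map X X' f"
proof -
  define P where "P U \<longleftrightarrow> U \<subseteq> f ` topspace X \<and> openin X {x \<in> topspace X. f x \<in> U}" for U
  have "istopology P"
    unfolding istopology_def
  proof (intro conjI allI impI)
    fix S T assume "P S" "P T"
    moreover have "{x \<in> topspace X. f x \<in> S \<inter> T} = {x \<in> topspace X. f x \<in> S} \<inter> {x \<in> topspace X. f x \<in> T}"
      by auto
    ultimately show "P (S \<inter> T)"
      unfolding P_def by auto
  next
    fix K assume "\<forall>S\<in>K. P S"
    moreover have "{x \<in> topspace X. f x \<in> \<Union>K} = (\<Union>S\<in>K. {x \<in> topspace X. f x \<in> S})"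
      by auto
    ultimately show "P (\<Union>K)"
      unfolding P_def by auto
  qed
  then have op: "openin (topology P) = P"
    by (rule topology_inverse')
  have "P (f ` topspace X)"
    unfolding P_def by (simp cong: conj_cong)
  then have "topspace (topology P) = f ` topspace X"
    by (metis P_def op openin_subset openin_topspace subset_antisym)
  then have "quotient_map X (topology P) f"
    unfolding quotient_map_def op by (auto simp: P_def)
  then show thesis ..
qed

text \<open>Stereographic projection from \<open>a\<close>. The puncture is there because the whole
  sphere is not planar; the regions used as charts below all avoid the centre of some cap.\<close>

lemma punctured_sphere_open_homeomorphic:
  fixes a :: "real^3" and S :: "(real^3) set"
  assumes "a \<in> sphere 0 1" "a \<notin> S" "openin (top_of_set (sphere 0 1)) S"
  obtains W :: "(real^2) set" where "open W" "S homeomorphic W"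
proof -
  have a0: "a \<noteq> 0" using assms by auto
  have "sphere 0 1 - {a} homeomorphic {x. a \<bullet> x = 0}"
    using assms a0 by (intro homeomorphic_punctured_sphere_hyperplane) auto
  also have "{x. a \<bullet> x = 0} homeomorphic (UNIV :: (real^2) set)"
    using a0 by (intro homeomorphic_affine_sets) (auto simp: affine_hyperplane)
  finally obtain f g where fg: "homeomorphism (sphere 0 1 - {a}) (UNIV :: (real^2) set) f g"
    by (auto simp: homeomorphic_def)
  have "openin (top_of_set (sphere 0 1 - {a})) S"
    using assms(2,3) openin_subset_trans[of "sphere 0 1" S "sphere 0 1 - {a}"]
      openin_imp_subset by blast
  then have "openin (top_of_set UNIV) (f ` S)" "S \<subseteq> sphere 0 1 - {a}"
    using homeomorphism_imp_open_map[OF fg] openin_imp_subset by blast+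
  then have "open (f ` S)" "homeomorphism S (f ` S) f g"
    using homeomorphism_of_subsets[OF fg, of S "f ` S"] by auto
  then show thesis
    using that homeomorphic_def by blast
qed

section \<open>Reflections exchanging two unit vectors\<close>

lemma continuous_on_swap_reflection [continuous_intros]:
  "continuous_on S g \<Longrightarrow> continuous_on S (\<lambda>x. swap_reflection a b (g x))"
  unfolding swap_reflection_def divide_inverse by (intro continuous_intros)

lemma swap_reflection_inner:
  "swap_reflection a b x \<bullet> swap_reflection a b y = x \<bullet> y"
proof (cases "a = b")
  case False
  define d where "d = a - b"
  have "d \<bullet> d \<noteq> 0" using False by (simp add: d_def)
  then show ?thesis
    unfolding swap_reflection_def d_def[symmetric]
    by (simp add: inner_diff_left inner_diff_right inner_commute)
qed (simp add: swap_reflection_def)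

lemma swap_reflection_norm: "norm (swap_reflection a b x) = norm x"
  by (simp add: norm_eq_sqrt_inner swap_reflection_inner)

lemma swap_reflection_idem: "swap_reflection a b (swap_reflection a b x) = x"
proof (cases "a = b")
  case False
  define d where "d = a - b"
  have "d \<bullet> d \<noteq> 0" using False by (simp add: d_def)
  then show ?thesis
    unfolding swap_reflection_def d_def[symmetric]
    by (simp add: inner_diff_left inner_diff_right flip: scaleR_add_left)
qed (simp add: swap_reflection_def)

text \<open>For unit vectors \<open>2 * ((a - b) \<bullet> a)\<close> is the squared length of
  \<open>a - b\<close>, so the reflection subtracts exactly \<open>a - b\<close> from
  \<open>a\<close>.\<close>

lemma swap_reflection_left:
  assumes "norm a = 1" "norm b = 1"
  shows "swap_reflection a b a = b"
proof (cases "a = b")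
  case False
  have 1: "a \<bullet> a = 1" "b \<bullet> b = 1" using assms by (auto simp: norm_eq_1)
  have "2 * ((a - b) \<bullet> a) = (a - b) \<bullet> (a - b)"
    by (simp add: inner_diff_left inner_diff_right 1 inner_commute)
  moreover have "(a - b) \<bullet> (a - b) \<noteq> 0" using False by simp
  ultimately show ?thesis by (simp add: swap_reflection_def)
qed (simp add: swap_reflection_def)

lemma swap_reflection_inner_left:
  assumes "norm a = 1" "norm b = 1"
  shows "a \<bullet> swap_reflection a b x = b \<bullet> x"
  by (metis assms swap_reflection_left swap_reflection_inner swap_reflection_idem)

lemma swap_reflection_inner_right:
  assumes "norm a = 1" "norm b = 1"
  shows "b \<bullet> swap_reflection a b x = a \<bullet> x"
  by (metis assms swap_reflection_inner_left swap_reflection_idem)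

section \<open>The holed sphere and its gluing map\<close>

text \<open>The caps above height \<open>c0\<close> are disjoint; the discs removed are the caps above the
  height \<open>c\<close> halfway between \<open>c0\<close> and \<open>1\<close>, which leaves a collar around each of them.\<close>

locale capped_sphere =
  fixes h :: nat and p :: "nat \<Rightarrow> real^3" and c0 :: real
  assumes h_pos: "0 < h"
    and norm_p: "i < 2 * h \<Longrightarrow> norm (p i) = 1"
    and c0_gt: "-1 < c0" and c0_lt: "c0 < 1"
    and disjoint: "\<lbrakk>i < 2 * h; j < 2 * h; i \<noteq> j; norm x = 1; c0 \<le> p i \<bullet> x\<rbrakk> \<Longrightarrow> p j \<bullet> x < c0"
begin

definition c :: real where "c = (1 + c0) / 2"

definition Y :: "(real^3) set" where "Y = holed_sphere (2 * h) p (\<lambda>_. c)"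

abbreviation sw :: "nat \<Rightarrow> real^3 \<Rightarrow> real^3" where
  "sw i \<equiv> swap_reflection (p (2 * i)) (p (Suc (2 * i)))"

text \<open>The points of the quotient space are represented by points of \<open>Y\<close>, those of a glued pair
  of boundary circles by points of the circle with even index.\<close>

definition glue :: "real^3 \<Rightarrow> real^3" where
  "glue x = (if \<exists>i<h. p (Suc (2 * i)) \<bullet> x = c
     then sw (THE i. i < h \<and> p (Suc (2 * i)) \<bullet> x = c) x else x)"

lemma c_bounds: "c0 < c" "c < 1" "-1 < c"
  using c0_gt c0_lt by (auto simp: c_def)

lemma mem_Y: "x \<in> Y \<longleftrightarrow> norm x = 1 \<and> (\<forall>i<2 * h. p i \<bullet> x \<le> c)"
  by (auto simp: Y_def holed_sphere_def not_less)

lemma cap_unique: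
  "\<lbrakk>i < 2 * h; j < 2 * h; norm x = 1; c0 \<le> p i \<bullet> x; c0 \<le> p j \<bullet> x\<rbrakk> \<Longrightarrow> i = j"
  using disjoint by (metis not_less)

text \<open>Only cap \<open>k\<close> has to be checked: height at least \<open>c0\<close> over it
  forces height below \<open>c0\<close>, hence below \<open>c\<close>, over all other caps.\<close>

lemma mem_Y_I:
  assumes "k < 2 * h" "norm x = 1" "c0 \<le> p k \<bullet> x" "p k \<bullet> x \<le> c"
  shows "x \<in> Y"
  using assms disjoint[of k _ x] c_bounds by (fastforce simp: mem_Y)

lemma sw_inner:
  assumes "i < h"
  shows "p (2 * i) \<bullet> sw i x = p (Suc (2 * i)) \<bullet> x" "p (Suc (2 * i)) \<bullet> sw i x = p (2 * i) \<bullet> x"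
  using assms by (simp_all add: swap_reflection_inner_left swap_reflection_inner_right norm_p)

lemma glue_odd:
  assumes "i < h" "norm x = 1" "p (Suc (2 * i)) \<bullet> x = c"
  shows "glue x = sw i x"
proof -
  have "(THE i. i < h \<and> p (Suc (2 * i)) \<bullet> x = c) = i"
  proof (rule the_equality)
    fix j assume "j < h \<and> p (Suc (2 * j)) \<bullet> x = c"
    then show "j = i"
      using cap_unique[of "Suc (2 * i)" "Suc (2 * j)" x] assms c_bounds by simp
  qed (use assms in auto)
  then show ?thesis using assms by (auto simp: glue_def)
qed

lemma glue_other: "(\<And>i. i < h \<Longrightarrow> p (Suc (2 * i)) \<bullet> x \<noteq> c) \<Longrightarrow> glue x = x"
  by (auto simp: glue_def)

lemma glue_even:
  assumes "i < h" "norm x = 1" "c0 \<le> p (2 * i) \<bullet> x"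
  shows "glue x = x"
proof (rule glue_other)
  fix j assume "j < h"
  then have "p (Suc (2 * j)) \<bullet> x < c0"
    using disjoint[of "2 * i" "Suc (2 * j)" x] assms by (simp add: even_Suc double_not_eq_Suc_double)
  then show "p (Suc (2 * j)) \<bullet> x \<noteq> c" using c_bounds by simp
qed

text \<open>Directed from the even circle to the odd one; its reflexive symmetric closure is the
  relation demanded by \<open>sphere_with_handles\<close>.\<close>

definition glued :: "real^3 \<Rightarrow> real^3 \<Rightarrow> bool" where
  "glued x y \<longleftrightarrow> (\<exists>i<h. p (2 * i) \<bullet> x = c \<and> y = sw i x)"

text \<open>\<open>glue\<close> moves only points of odd circles, each to its mirror image on the
  even circle, so the fibres are single points and mirror pairs. Disjointness of the caps makes the
  index of the circle unique.\<close>

lemma glue_eq_iff: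
  assumes "norm x = 1" "norm y = 1"
  shows "glue x = glue y \<longleftrightarrow> x = y \<or> glued x y \<or> glued y x"
proof -
  have glued_imp: "glue x = glue y" if "glued x y" "norm x = 1" for x y
  proof -
    obtain i where i: "i < h" "p (2 * i) \<bullet> x = c" "y = sw i x"
      using \<open>glued x y\<close> unfolding glued_def by blast
    have "glue x = x"
      using i that c_bounds by (intro glue_even[of i]) auto
    moreover have "glue y = sw i y"
      using i that by (intro glue_odd) (auto simp: sw_inner swap_reflection_norm)
    ultimately show ?thesis using i by (simp add: swap_reflection_idem)
  qed
  have odd_other: "glued y x" if "i < h" "p (Suc (2 * i)) \<bullet> x = c" "norm x = 1" "y = glue x" for i x y
    unfolding glued_def using that glue_odd[of i x] sw_inner[of i x]
    by (auto simp: swap_reflection_idem)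
  show ?thesis
  proof
    assume eq: "glue x = glue y"
    \<comment> \<open>Each of \<open>x\<close> and \<open>y\<close> is on an odd circle, where
      \<open>glue\<close> reflects it, or is fixed. If both are reflected, their common image lies
      on a single even circle, so the same reflection was used and can be undone.\<close>
    consider (1) i j where "i < h" "j < h" "p (Suc (2 * i)) \<bullet> x = c" "p (Suc (2 * j)) \<bullet> y = c"
      | (2) i where "i < h" "p (Suc (2 * i)) \<bullet> x = c" "glue y = y"
      | (3) i where "i < h" "p (Suc (2 * i)) \<bullet> y = c" "glue x = x"
      | (4) "glue x = x" "glue y = y"
      using glue_other by metis
    then show "x = y \<or> glued x y \<or> glued y x"
    proof cases
      case 1
      have sw: "sw i x = sw j y"
        using eq glue_odd 1 assms by metis
      moreover have "p (2 * i) \<bullet> sw i x = c" "p (2 * j) \<bullet> sw j y = c"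
        using 1 by (simp_all add: sw_inner)
      ultimately have "2 * i = 2 * j"
        using 1 assms c_bounds cap_unique[of "2 * i" "2 * j" "sw i x"]
        by (simp add: swap_reflection_norm)
      then show ?thesis
        using sw swap_reflection_idem by (metis mult_cancel1 zero_neq_numeral)
    next
      case 2
      then show ?thesis using odd_other[of i x y] eq assms by simp
    next
      case 3
      then show ?thesis using odd_other[of i y x] eq assms by simp
    next
      case 4
      then show ?thesis using eq by metis
    qed
  next
    assume "x = y \<or> glued x y \<or> glued y x"
    then show "glue x = glue y"
      using glued_imp assms by metis
  qed
qed

lemma compact_Y: "compact Y"
proof -
  have "Y = sphere 0 1 \<inter> (\<Inter>i<2 * h. {x. p i \<bullet> x \<le> c})"
    by (auto simp: mem_Y)
  then show ?thesis
    by (metis compact_Int_closed compact_sphere closed_INT closed_halfspace_le)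
qed

text \<open>Needed for the Hausdorff property of the quotient. A closed set is enlarged by the
  identification only by finitely many mirror images of compact pieces, so its saturation is
  closed.\<close>

lemma closed_map_glue:
  assumes q: "quotient_map (top_of_set Y) X glue"
  shows "closed_map (top_of_set Y) X glue"
  unfolding closed_map_def
proof (intro allI impI)
  fix C assume C: "closedin (top_of_set Y) C"
  then have CY: "C \<subseteq> Y" "compact C"
    using closedin_imp_subset closedin_compact compact_Y by blast+
  \<comment> \<open>Up to intersection with \<open>Y\<close> this is the saturation of
    \<open>C\<close>: the two unions reflect its points on even and on odd circles.\<close>
  define B where "B = C \<union> (\<Union>i<h. sw i ` (C \<inter> {x. p (2 * i) \<bullet> x = c}))
    \<union> (\<Union>i<h. sw i ` (C \<inter> {x. p (Suc (2 * i)) \<bullet> x = c}))"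
  have "compact B"
    unfolding B_def
    by (intro compact_Un compact_UN finite_lessThan compact_continuous_image compact_Int_closed
          closed_hyperplane continuous_intros CY)
  moreover have "{x \<in> Y. glue x \<in> glue ` C} = B \<inter> Y"
  proof (intro set_eqI iffI)
    fix x assume "x \<in> {x \<in> Y. glue x \<in> glue ` C}"
    then obtain y where xy: "x \<in> Y" "y \<in> C" "glue x = glue y" by auto
    then have "x = y \<or> glued x y \<or> glued y x"
      using glue_eq_iff CY by (auto simp: mem_Y)
    moreover have "x \<in> B" if "glued x y"
    proof -
      obtain i where i: "i < h" "p (2 * i) \<bullet> x = c" "y = sw i x"
        using \<open>glued x y\<close> unfolding glued_def by blast
      then have "x = sw i y" "p (Suc (2 * i)) \<bullet> y = c"
        by (simp_all add: swap_reflection_idem sw_inner)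
      then show ?thesis using i xy by (auto simp: B_def)
    qed
    moreover have "x \<in> B" if "glued y x"
      using that xy by (auto simp: glued_def B_def)
    ultimately show "x \<in> B \<inter> Y" using xy by (auto simp: B_def)
  next
    fix x assume x: "x \<in> B \<inter> Y"
    consider "x \<in> C" | i y where "i < h" "y \<in> C" "p (2 * i) \<bullet> y = c" "x = sw i y"
      | i y where "i < h" "y \<in> C" "p (Suc (2 * i)) \<bullet> y = c" "x = sw i y"
      using x by (auto simp: B_def)
    then obtain y where y: "y \<in> C" "x = y \<or> glued x y \<or> glued y x"
    proof cases
      case 2
      then have "glued y x"
        unfolding glued_def by blast
      then show ?thesis using 2 that by blast
    next
      case 3
      then have "glued x y"
        unfolding glued_def by (auto simp: swap_reflection_idem sw_inner)
      then show ?thesis using 3 that by blast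
    qed blast
    then have "glue x = glue y"
      using x CY glue_eq_iff[of x y] unfolding mem_Y subset_iff Int_iff by blast
    then show "x \<in> {x \<in> Y. glue x \<in> glue ` C}"
      using x y by blast
  qed
  ultimately have "closedin (top_of_set Y) {x \<in> Y. glue x \<in> glue ` C}"
    by (metis compact_imp_closed closedin_closed_Int Int_commute)
  moreover have "glue ` C \<subseteq> topspace X"
    using CY quotient_imp_surjective_map[OF q] by auto
  ultimately show "closedin X (glue ` C)"
    using q by (simp add: quotient_map_closedin)
qed

end

section \<open>Flipping a zone of the sphere\<close>

text \<open>The reflection in the circle at height \<open>(1 + c0) / 2\<close>, along meridians of the axis \<open>a\<close>,
  of the zone of the sphere between the heights \<open>c0\<close> and \<open>1\<close>.\<close>

definition zone :: "real^3 \<Rightarrow> real \<Rightarrow> (real^3) set" where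
  "zone a c0 = {y. norm y = 1 \<and> c0 < a \<bullet> y \<and> a \<bullet> y < 1}"

definition zone_flip :: "real^3 \<Rightarrow> real \<Rightarrow> real^3 \<Rightarrow> real^3" where
  "zone_flip a c0 x = (1 + c0 - a \<bullet> x) *\<^sub>R a
     + sqrt ((1 - (1 + c0 - a \<bullet> x)\<^sup>2) / (1 - (a \<bullet> x)\<^sup>2)) *\<^sub>R (x - (a \<bullet> x) *\<^sub>R a)"

context
  fixes a :: "real^3" and c0 :: real
  assumes a: "norm a = 1" and c0: "-1 < c0"
begin

text \<open>Because \<open>-1 < c0\<close>, the height and the flipped height both lie strictly
  between \<open>-1\<close> and \<open>1\<close>; this keeps the root in \<open>zone_flip\<close>
  continuous and the flip invertible.\<close>

lemma zone_height:
  assumes "x \<in> zone a c0"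
  shows "0 < 1 - (a \<bullet> x)\<^sup>2" "0 < 1 - (1 + c0 - a \<bullet> x)\<^sup>2"
proof -
  have "\<bar>a \<bullet> x\<bar> < 1" "\<bar>1 + c0 - a \<bullet> x\<bar> < 1" using assms c0 by (auto simp: zone_def)
  then show "0 < 1 - (a \<bullet> x)\<^sup>2" "0 < 1 - (1 + c0 - a \<bullet> x)\<^sup>2"
    by (simp_all add: abs_square_less_1)
qed

lemma zone_flip_inner: "a \<bullet> zone_flip a c0 x = 1 + c0 - a \<bullet> x"
proof -
  have "a \<bullet> a = 1" using a by (simp add: norm_eq_1)
  then show ?thesis by (simp add: zone_flip_def inner_add_right inner_diff_right)
qed

text \<open>With \<open>s\<close> the height and \<open>t\<close> the flipped height, the component
  orthogonal to \<open>a\<close> has squared length \<open>1 - s\<^sup>2\<close>, and the factor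
  \<open>r\<close> rescales it to \<open>1 - t\<^sup>2\<close>.\<close>

lemma zone_flip_mem:
  assumes x: "x \<in> zone a c0"
  shows "zone_flip a c0 x \<in> zone a c0"
proof -
  define s where "s = a \<bullet> x"
  define t where "t = 1 + c0 - s"
  define r where "r = sqrt ((1 - t\<^sup>2) / (1 - s\<^sup>2))"
  have aa: "a \<bullet> a = 1" "x \<bullet> x = 1" using a x by (auto simp: zone_def norm_eq_1)
  have pos: "0 < 1 - s\<^sup>2" "0 < 1 - t\<^sup>2" using zone_height[OF x] by (auto simp: s_def t_def)
  then have r2: "r\<^sup>2 = (1 - t\<^sup>2) / (1 - s\<^sup>2)" by (simp add: r_def)
  have fl: "zone_flip a c0 x = t *\<^sub>R a + r *\<^sub>R (x - s *\<^sub>R a)"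
    by (simp add: zone_flip_def s_def t_def r_def)
  have "a \<bullet> (x - s *\<^sub>R a) = 0" "(x - s *\<^sub>R a) \<bullet> (x - s *\<^sub>R a) = 1 - s\<^sup>2"
    using aa by (auto simp: s_def inner_diff_left inner_diff_right inner_commute power2_eq_square)
  then have "zone_flip a c0 x \<bullet> zone_flip a c0 x = t\<^sup>2 + r\<^sup>2 * (1 - s\<^sup>2)"
    unfolding fl by (simp add: inner_add_left inner_add_right aa inner_commute power2_eq_square)
  also have "\<dots> = 1" using pos by (simp add: r2)
  finally have "norm (zone_flip a c0 x) = 1" by (simp add: norm_eq_1)
  then show ?thesis using x by (auto simp: zone_def zone_flip_inner)
qed

lemma zone_flip_idem:
  assumes x: "x \<in> zone a c0"
  shows "zone_flip a c0 (zone_flip a c0 x) = x"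
proof -
  define s where "s = a \<bullet> x"
  define t where "t = 1 + c0 - s"
  define r where "r = sqrt ((1 - t\<^sup>2) / (1 - s\<^sup>2))"
  have pos: "0 < 1 - s\<^sup>2" "0 < 1 - t\<^sup>2" using zone_height[OF x] by (auto simp: s_def t_def)
  have fl: "zone_flip a c0 x = t *\<^sub>R a + r *\<^sub>R (x - s *\<^sub>R a)"
    by (simp add: zone_flip_def s_def t_def r_def)
  have at: "a \<bullet> zone_flip a c0 x = t" by (simp add: zone_flip_inner s_def t_def)
  have "zone_flip a c0 (zone_flip a c0 x)
      = s *\<^sub>R a + sqrt ((1 - s\<^sup>2) / (1 - t\<^sup>2)) *\<^sub>R (r *\<^sub>R (x - s *\<^sub>R a))"
    unfolding zone_flip_def[of a c0 "zone_flip a c0 x"] at by (simp add: fl t_def)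
  also have "sqrt ((1 - s\<^sup>2) / (1 - t\<^sup>2)) *\<^sub>R (r *\<^sub>R (x - s *\<^sub>R a)) = x - s *\<^sub>R a"
    using pos by (simp add: r_def flip: real_sqrt_mult)
  finally show ?thesis by simp
qed

lemma zone_flip_fixed:
  assumes "x \<in> zone a c0" "a \<bullet> x = (1 + c0) / 2"
  shows "zone_flip a c0 x = x"
proof -
  have "1 + c0 - a \<bullet> x = a \<bullet> x" using assms by (simp add: field_simps)
  then show ?thesis using zone_height[OF assms(1)] by (simp add: zone_flip_def)
qed

lemma continuous_on_zone_flip: "continuous_on (zone a c0) (zone_flip a c0)"
  unfolding zone_flip_def
  by (intro continuous_intros) (use zone_height in force)

end

section \<open>Charts of the quotient\<close>

context capped_sphere
begin

text \<open>The collars of both circles of pair \<open>i\<close> are unfolded into one open zone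
  around \<open>a\<close>: the even collar stays at heights up to \<open>c\<close>, the odd one is
  reflected to \<open>a\<close> and then flipped to the heights from \<open>c\<close> upward. Since
  the flip fixes height \<open>c\<close>, the two halves match along the glued circle.\<close>

lemma collar_chart:
  assumes q: "quotient_map (top_of_set Y) X glue" and i: "i < h"
  obtains V where "openin X V" "\<And>x. \<lbrakk>x \<in> Y; c0 < p (2 * i) \<bullet> x\<rbrakk> \<Longrightarrow> glue x \<in> V"
    "subtopology X V homeomorphic_space top_of_set (zone (p (2 * i)) c0)"
proof -
  define a b where "a = p (2 * i)" and "b = p (Suc (2 * i))"
  let ?sw = "swap_reflection a b"
  let ?Z = "zone a c0"
  have ab: "norm a = 1" "norm b = 1" using i by (auto simp: a_def b_def norm_p)
  have sw_ab: "a \<bullet> ?sw x = b \<bullet> x" "b \<bullet> ?sw x = a \<bullet> x" "norm (?sw x) = norm x"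
      "?sw (?sw x) = x" for x
    using ab by (simp_all add: swap_reflection_inner_left swap_reflection_inner_right
        swap_reflection_norm swap_reflection_idem)
  have dab: "\<not> (c0 \<le> a \<bullet> x \<and> c0 \<le> b \<bullet> x)" if "norm x = 1" for x
    using that cap_unique[of "2 * i" "Suc (2 * i)" x] i by (auto simp: a_def b_def)
  have Y_I: "x \<in> Y" if "norm x = 1" "c0 \<le> a \<bullet> x \<and> a \<bullet> x \<le> c \<or> c0 \<le> b \<bullet> x \<and> b \<bullet> x \<le> c" for x
    using that mem_Y_I[of "2 * i" x] mem_Y_I[of "Suc (2 * i)" x] i by (auto simp: a_def b_def)
  have Y_le: "norm x = 1" "a \<bullet> x \<le> c" "b \<bullet> x \<le> c" if "x \<in> Y" for x
    using that i by (auto simp: mem_Y a_def b_def)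
  have glue_sw: "glue (?sw x) = glue x" if "norm x = 1" "a \<bullet> x = c \<or> b \<bullet> x = c" for x
  proof -
    have "glued x (?sw x) \<or> glued (?sw x) x"
      unfolding glued_def using that(2)
    proof
      assume "a \<bullet> x = c"
      then show "(\<exists>i<h. p (2 * i) \<bullet> x = c \<and> ?sw x = sw i x) \<or>
        (\<exists>i<h. p (2 * i) \<bullet> ?sw x = c \<and> x = sw i (?sw x))"
        using i by (auto simp: a_def b_def)
    next
      assume "b \<bullet> x = c"
      then have "p (2 * i) \<bullet> ?sw x = c" "x = sw i (?sw x)"
        using sw_ab by (simp_all flip: a_def b_def add: sw_ab)
      then show "(\<exists>i<h. p (2 * i) \<bullet> x = c \<and> ?sw x = sw i x) \<or>
        (\<exists>i<h. p (2 * i) \<bullet> ?sw x = c \<and> x = sw i (?sw x))"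
        using i by blast
    qed
    then show ?thesis using glue_eq_iff that sw_ab by metis
  qed
  define T where "T = {x \<in> Y. c0 < a \<bullet> x \<or> c0 < b \<bullet> x}"
  define V where "V = glue ` T"
  have TY: "T \<subseteq> Y" by (auto simp: T_def)
  \<comment> \<open>Gluing along a pair \<open>j\<close> other than \<open>i\<close> is impossible
    here: a point above height \<open>c0\<close> over a cap of pair \<open>i\<close> lies on no
    circle of another pair.\<close>
  have T_glued: "x = y \<or> y = ?sw x \<and> (a \<bullet> x = c \<or> b \<bullet> x = c)"
    if "x \<in> Y" "y \<in> T" "glue x = glue y" for x y
  proof -
    have *: "y = ?sw x \<and> a \<bullet> x = c \<or> x = ?sw y \<and> a \<bullet> y = c"
      if "glued x y" "norm x = 1" "c0 < a \<bullet> x \<or> c0 < b \<bullet> x \<or> c0 < a \<bullet> y \<or> c0 < b \<bullet> y" for x y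
    proof -
      obtain j where j: "j < h" "p (2 * j) \<bullet> x = c" "y = sw j x"
        using \<open>glued x y\<close> unfolding glued_def by blast
      have jy: "p (Suc (2 * j)) \<bullet> y = c" "norm y = 1"
        using j that by (simp_all add: sw_inner swap_reflection_norm)
      have "j = i"
        using that(3)
      proof (elim disjE)
        assume "c0 < a \<bullet> x" then show ?thesis
          using cap_unique[of "2 * i" "2 * j" x] i j c_bounds that by (simp add: a_def)
      next
        assume "c0 < b \<bullet> x" then show ?thesis
          using cap_unique[of "Suc (2 * i)" "2 * j" x] i j c_bounds that
          by (simp add: b_def)
      next
        assume "c0 < a \<bullet> y" then show ?thesis
          using cap_unique[of "2 * i" "Suc (2 * j)" y] i j c_bounds jy
          by (simp add: a_def)
      next
        assume "c0 < b \<bullet> y" then show ?thesis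
          using cap_unique[of "Suc (2 * i)" "Suc (2 * j)" y] i j c_bounds jy by (simp add: b_def)
      qed
      then show ?thesis using j by (simp add: a_def b_def)
    qed
    have nn: "norm x = 1" "norm y = 1" using that TY by (auto simp: mem_Y)
    then have "x = y \<or> glued x y \<or> glued y x"
      using that glue_eq_iff by blast
    moreover have "c0 < a \<bullet> y \<or> c0 < b \<bullet> y" using that by (auto simp: T_def)
    ultimately show ?thesis using *[of x y] *[of y x] nn sw_ab by metis
  qed
  have T_sat: "{x \<in> topspace (top_of_set Y). glue x \<in> V} = T"
  proof -
    have "x \<in> T" if x: "x \<in> Y" "y \<in> T" "glue x = glue y" for x y
    proof -
      have "c0 < a \<bullet> y \<or> c0 < b \<bullet> y" using x by (simp add: T_def)
      moreover have "x = y \<or> y = ?sw x" using T_glued[OF x] by blast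
      ultimately have "c0 < a \<bullet> x \<or> c0 < b \<bullet> x" using sw_ab by metis
      then show ?thesis using x(1) unfolding T_def by blast
    qed
    then show ?thesis using TY by (auto simp: V_def)
  qed
  have "T = Y \<inter> ({x. c0 < a \<bullet> x} \<union> {x. c0 < b \<bullet> x})" by (auto simp: T_def)
  then have opT: "openin (top_of_set Y) T"
    by (simp add: open_Un open_halfspace_gt openin_open_Int)
  have "V \<subseteq> topspace X"
    using TY quotient_imp_surjective_map[OF q] by (auto simp: V_def)
  then have "openin (top_of_set Y) {x \<in> topspace (top_of_set Y). glue x \<in> V} = openin X V"
    using q unfolding quotient_map_def by blast
  then have V: "openin X V"
    using opT unfolding T_sat by simp
  \<comment> \<open>Restricting a quotient map to an open saturated set gives a quotient map again,
    so \<open>F\<close> below can descend to \<open>V\<close>.\<close>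
  have qT: "quotient_map (top_of_set T) (subtopology X V) glue"
    using quotient_map_restriction[OF q T_sat] V TY
    by (simp add: subtopology_subtopology Int_absorb1)
  have contf: "continuous_map (top_of_set Y) X glue"
    by (rule quotient_imp_continuous_map[OF q])

  note fl = zone_flip_mem[OF ab(1) c0_gt] zone_flip_inner[OF ab(1) c0_gt]
    zone_flip_idem[OF ab(1) c0_gt] zone_flip_fixed[OF ab(1) c0_gt]
  have cfl: "continuous_on ?Z (zone_flip a c0)"
    by (rule continuous_on_zone_flip[OF ab(1) c0_gt])
  have c2: "1 + c0 = 2 * c" by (simp add: c_def)

  \<comment> \<open>The unfolding before gluing. The test \<open>a \<bullet> y \<le> c0\<close>
    singles out the odd collar, because each point of \<open>T\<close> is above \<open>c0\<close>
    over exactly one of the two caps.\<close>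
  define F where "F y = (if a \<bullet> y \<le> c0 then zone_flip a c0 (?sw y) else y)" for y
  have F_left: "F y = y" if "c0 < a \<bullet> y" for y
    using that by (simp add: F_def)
  have F_right: "F y = zone_flip a c0 (?sw y)" if "c0 < b \<bullet> y" "norm y = 1" for y
    using that dab[of y] by (auto simp: F_def)
  have Z_left: "y \<in> ?Z" if "y \<in> T" "c0 < a \<bullet> y" for y
    using that c_bounds Y_le[of y] by (auto simp: T_def zone_def)
  have Z_right: "?sw y \<in> ?Z" if "y \<in> T" "c0 < b \<bullet> y" for y
    using that c_bounds Y_le[of y] by (auto simp: T_def zone_def sw_ab)
  have T_cases: "c0 < a \<bullet> y \<or> c0 < b \<bullet> y" if "y \<in> T" for y
    using that by (auto simp: T_def)
  have FT: "F y \<in> ?Z" if "y \<in> T" for y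
    using T_cases[OF that] Z_left[OF that] Z_right[OF that] F_left F_right TY that fl(1)
    by (auto simp: mem_Y subset_iff)
  have contF: "continuous_map (top_of_set T) (top_of_set ?Z) F"
  proof -
    have "continuous_map (top_of_set T) euclidean F"
      unfolding F_def
    proof (rule continuous_map_cases_le)
      have "?sw ` {y \<in> T. a \<bullet> y \<le> c0} \<subseteq> ?Z"
        using Z_right T_cases by fastforce
      then show "continuous_map (subtopology (top_of_set T) {x \<in> topspace (top_of_set T). a \<bullet> x \<le> c0})
          euclidean (\<lambda>y. zone_flip a c0 (?sw y))"
        by (auto simp: subtopology_subtopology Int_absorb1
            intro!: continuous_on_compose2[OF cfl] continuous_intros)
      \<comment> \<open>This matching condition is vacuous: at height exactly \<open>c0\<close> over
        \<open>a\<close>, a point of \<open>T\<close> would be above \<open>c0\<close> over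
        \<open>b\<close>, against the disjointness of the caps.\<close>
      show "zone_flip a c0 (?sw x) = x" if "x \<in> topspace (top_of_set T)" "a \<bullet> x = c0" for x
      proof -
        have "norm x = 1" "c0 < b \<bullet> x" using that T_cases[of x] Y_le[of x] TY by auto
        then show ?thesis using dab[of x] that by simp
      qed
    qed (auto intro!: continuous_intros simp: subtopology_subtopology Int_absorb1)
    then show ?thesis using FT by (auto simp: continuous_map_in_subtopology)
  qed
  obtain G where G: "continuous_map (subtopology X V) (top_of_set ?Z) G"
      and GF: "\<And>x. x \<in> T \<Longrightarrow> G (glue x) = F x"
  proof (rule quotient_map_lift_exists[OF qT contF])
    fix x y assume xy: "x \<in> topspace (top_of_set T)" "y \<in> topspace (top_of_set T)" "glue x = glue y"
    then have xyT: "x \<in> T" "y \<in> T" by auto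
    have *: "F (?sw x) = F x" if "x \<in> T" "a \<bullet> x = c" for x
    proof -
      have "F (?sw x) = zone_flip a c0 x"
        using F_right[of "?sw x"] that c_bounds TY by (auto simp: sw_ab mem_Y)
      also have "\<dots> = x" using that Z_left[of x] c_bounds by (auto intro!: fl(4) simp: c_def)
      also have "\<dots> = F x" using that c_bounds by (simp add: F_left)
      finally show ?thesis .
    qed
    show "F x = F y"
      using T_glued[of x y] xyT xy TY *[of x] *[of y] sw_ab by (metis subsetD)
  qed auto

  \<comment> \<open>The inverse of the descended map \<open>G\<close>: the upper half of the zone is
    flipped down and reflected to the odd collar. At height \<open>c\<close> the flip is the
    identity and \<open>glue\<close> identifies mirror images, so the two branches agree.\<close>
  define K where "K y = (if a \<bullet> y \<le> c then glue y else glue (?sw (zone_flip a c0 y)))" for y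
  have ZT_left: "y \<in> T" if "y \<in> ?Z" "a \<bullet> y \<le> c" for y
    using that Y_I[of y] by (auto simp: T_def zone_def)
  have ZT_right: "?sw (zone_flip a c0 y) \<in> T" if "y \<in> ?Z" "c \<le> a \<bullet> y" for y
    using that fl(1)[of y] fl(2)[of y] Y_I[of "?sw (zone_flip a c0 y)"] c2
    by (auto simp: T_def sw_ab zone_def)
  have contK: "continuous_map (top_of_set ?Z) (subtopology X V) K"
    unfolding continuous_map_in_subtopology
  proof
    have cfT: "continuous_map (top_of_set T) X glue"
      using continuous_map_from_subtopology_mono[OF contf] TY by blast
    show "continuous_map (top_of_set ?Z) X K"
      unfolding K_def
    proof (rule continuous_map_cases_le)
      show "continuous_map (subtopology (top_of_set ?Z) {x \<in> topspace (top_of_set ?Z). a \<bullet> x \<le> c}) X glue"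
        using ZT_left by (auto simp: subtopology_subtopology intro!: continuous_map_from_subtopology_mono[OF cfT])
      have "continuous_map (top_of_set {x \<in> ?Z. c \<le> a \<bullet> x}) (top_of_set T) (\<lambda>y. ?sw (zone_flip a c0 y))"
        using ZT_right by (auto simp: continuous_map_in_subtopology
            intro!: continuous_intros continuous_on_subset[OF cfl])
      then have "continuous_map (top_of_set {x \<in> ?Z. c \<le> a \<bullet> x}) X (\<lambda>y. glue (?sw (zone_flip a c0 y)))"
        using continuous_map_compose[OF _ cfT] unfolding o_def by blast
      then show "continuous_map (subtopology (top_of_set ?Z) {x \<in> topspace (top_of_set ?Z). c \<le> a \<bullet> x})
          X (\<lambda>y. glue (?sw (zone_flip a c0 y)))"
        by (simp add: subtopology_subtopology Int_absorb1)
      show "glue x = glue (?sw (zone_flip a c0 x))" if "x \<in> topspace (top_of_set ?Z)" "a \<bullet> x = c" for x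
        using that fl(4)[of x] glue_sw[of x] by (auto simp: c_def zone_def)
    qed (auto intro!: continuous_intros)
    show "K \<in> topspace (top_of_set ?Z) \<rightarrow> V"
      using ZT_left ZT_right by (auto simp: K_def V_def)
  qed
  have GK: "G (K y) = y" if y: "y \<in> ?Z" for y
  proof (cases "a \<bullet> y \<le> c")
    case True
    then show ?thesis
      using ZT_left[OF y] y by (simp add: K_def GF F_left zone_def)
  next
    case False
    let ?w = "?sw (zone_flip a c0 y)"
    have w: "?w \<in> T" using ZT_right[OF y] False by simp
    have "c0 < b \<bullet> ?w" using fl(1)[OF y] by (simp add: sw_ab zone_def)
    then have "F ?w = zone_flip a c0 (zone_flip a c0 y)"
      using F_right[of ?w] w TY by (auto simp: sw_ab mem_Y)
    then show ?thesis using False w fl(3)[OF y] by (simp add: K_def GF)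
  qed
  have KG: "K (G v) = v" if "v \<in> V" for v
  proof -
    obtain y where y: "y \<in> T" "v = glue y" using \<open>v \<in> V\<close> by (auto simp: V_def)
    have ny: "norm y = 1" "a \<bullet> y \<le> c" "b \<bullet> y \<le> c" using y TY Y_le by auto
    from T_cases[OF y(1)] have "K (F y) = glue y"
    proof
      assume "c0 < a \<bullet> y"
      then show ?thesis using ny by (simp add: F_left K_def)
    next
      assume ybc: "c0 < b \<bullet> y"
      have z: "?sw y \<in> ?Z" using Z_right y ybc by blast
      have Fy: "F y = zone_flip a c0 (?sw y)" using F_right ybc ny by blast
      have aF: "a \<bullet> F y = 2 * c - b \<bullet> y" by (simp add: Fy fl(2) sw_ab c2)
      show ?thesis
      proof (cases "b \<bullet> y = c")
        case True
        then have "F y = ?sw y" unfolding Fy using z by (intro fl(4)) (simp_all add: sw_ab c_def)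
        then show ?thesis using aF True glue_sw[of y] ny by (simp add: K_def)
      next
        case False
        then have "\<not> a \<bullet> F y \<le> c" using aF ny by simp
        then show ?thesis by (simp add: K_def Fy fl(3)[OF z] sw_ab)
      qed
    qed
    then show ?thesis using y GF by simp
  qed
  have "homeomorphic_maps (subtopology X V) (top_of_set ?Z) G K"
    unfolding homeomorphic_maps_def using G contK GK KG by auto
  then have "subtopology X V homeomorphic_space top_of_set ?Z"
    by (auto simp: homeomorphic_space_def)
  moreover have "glue x \<in> V" if "x \<in> Y" "c0 < a \<bullet> x" for x
    using that by (auto simp: V_def T_def)
  ultimately show thesis
    using that V by (auto simp: a_def)
qed

end

lemma homeomorphic_imp_homeomorphic_space:
  assumes "S homeomorphic T"
  shows "top_of_set S homeomorphic_space top_of_set T"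
proof -
  obtain f g where fg: "homeomorphism S T f g"
    using assms by (auto simp: homeomorphic_def)
  have "homeomorphic_maps (top_of_set S) (top_of_set T) f g"
    using fg unfolding homeomorphic_maps_def homeomorphism_def
    by (simp add: image_subset_iff_funcset[symmetric])
  then show ?thesis
    by (auto simp: homeomorphic_space_def)
qed

context capped_sphere
begin

text \<open>Away from the boundary circles \<open>glue\<close> is the identity and \<open>V\<close>
  is saturated, so the quotient topology on \<open>V\<close> is the one inherited from the
  sphere.\<close>

lemma flat_chart:
  assumes q: "quotient_map (top_of_set Y) X glue"
  defines "V \<equiv> {y. norm y = 1 \<and> (\<forall>i<2 * h. p i \<bullet> y < c)}"
  shows "openin X V" "subtopology X V homeomorphic_space top_of_set V"
    "openin (top_of_set (sphere 0 1)) V"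
proof -
  have VY: "V \<subseteq> Y" by (auto simp: V_def mem_Y less_imp_le)
  have id: "glue y = y" if "y \<in> V" for y
  proof (rule glue_other)
    fix i assume "i < h"
    then have "Suc (2 * i) < 2 * h" by simp
    then have "p (Suc (2 * i)) \<bullet> y < c"
      using \<open>y \<in> V\<close> unfolding V_def by blast
    then show "p (Suc (2 * i)) \<bullet> y \<noteq> c" by simp
  qed
  have sat: "{x \<in> topspace (top_of_set Y). glue x \<in> V} = V"
  proof -
    have "x \<in> V" if x: "x \<in> Y" "glue x \<in> V" for x
    proof -
      have nx: "norm x = 1" using x by (simp add: mem_Y)
      have gx: "norm (glue x) = 1" using x by (simp add: V_def)
      have "glue x = glue (glue x)" using id x by simp
      then have "x = glue x \<or> glued x (glue x) \<or> glued (glue x) x"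
        using glue_eq_iff[OF nx gx] by blast
      moreover have "\<not> glued (glue x) x"
      proof
        assume "glued (glue x) x"
        then obtain i where i: "i < h" "p (2 * i) \<bullet> glue x = c"
          unfolding glued_def by blast
        then have "2 * i < 2 * h" by simp
        then have "p (2 * i) \<bullet> glue x < c" using x unfolding V_def by blast
        then show False using i by simp
      qed
      moreover have "\<not> glued x (glue x)"
      proof
        assume "glued x (glue x)"
        then obtain i where i: "i < h" "p (2 * i) \<bullet> x = c" "glue x = sw i x"
          unfolding glued_def by blast
        then have "p (Suc (2 * i)) \<bullet> glue x = c" "Suc (2 * i) < 2 * h" by (simp_all add: sw_inner)
        then show False using x unfolding V_def by fastforce
      qed
      ultimately show ?thesis using x by metis
    qed
    then show ?thesis using id VY by auto
  qed
  have "V = sphere 0 1 \<inter> (\<Inter>i<2 * h. {y. p i \<bullet> y < c})"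
    by (auto simp: V_def)
  moreover have "open (\<Inter>i<2 * h. {y. p i \<bullet> y < c})"
    by (intro open_INT) (auto simp: open_halfspace_lt)
  ultimately show op: "openin (top_of_set (sphere 0 1)) V"
    by (metis openin_open_Int)
  then have "openin (top_of_set Y) V"
    using openin_subset_trans[OF op VY] by (force simp: mem_Y)
  moreover have "V \<subseteq> topspace X"
    using VY id quotient_imp_surjective_map[OF q] by force
  then have "openin (top_of_set Y) {x \<in> topspace (top_of_set Y). glue x \<in> V} = openin X V"
    using q unfolding quotient_map_def by blast
  ultimately show XV: "openin X V"
    unfolding sat by simp
  have "quotient_map (top_of_set V) (subtopology X V) glue"
    using quotient_map_restriction[OF q sat] XV VY
    by (simp add: subtopology_subtopology Int_absorb1)
  moreover have "inj_on glue V" using id by (auto simp: inj_on_def)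
  ultimately have "homeomorphic_map (top_of_set V) (subtopology X V) glue"
    by (simp add: homeomorphic_map_def)
  then show "subtopology X V homeomorphic_space top_of_set V"
    by (metis homeomorphic_map_imp_homeomorphic_space homeomorphic_space_sym)
qed

section \<open>The quotient is a surface with \<open>h\<close> handles\<close>

text \<open>The quotient is compact and connected as a continuous image of \<open>Y\<close>, and
  Hausdorff because \<open>glue\<close> is a closed map on a compact Hausdorff, hence normal,
  space.\<close>

theorem quotient_is_surface:
  assumes "connected Y" "Y \<noteq> {}" and q: "quotient_map (top_of_set Y) X glue"
  shows "surface X" and "sphere_with_handles h X"
proof -
  have contf: "continuous_map (top_of_set Y) X glue"
    by (rule quotient_imp_continuous_map[OF q])
  have surj: "glue ` Y = topspace X"
    using quotient_imp_surjective_map[OF q] by simp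
  have "compact_space (top_of_set Y)" "Hausdorff_space (top_of_set Y)"
    using compact_Y by (auto simp: compact_space_subtopology Hausdorff_space_subtopology)
  then have "normal_space (top_of_set Y)"
    using compact_Hausdorff_or_regular_imp_normal_space by blast
  then have haus: "Hausdorff_space X"
    using normal_Hausdorff_space_closed_continuous_map_image[OF _ _ closed_map_glue[OF q] contf]
      surj \<open>Hausdorff_space (top_of_set Y)\<close> by simp
  have "compactin X (glue ` Y)"
    using image_compactin[OF _ contf] compact_Y by (simp add: compactin_subtopology)
  then have comp: "compact_space X" by (simp add: compact_space_def surj)
  have "connectedin X (glue ` Y)"
    using connectedin_continuous_map_image[OF contf] assms(1) by (simp add: connectedin_subtopology)
  then have conn: "connected_space X" by (simp add: surj connectedin_topspace)
  have p0: "p 0 \<in> sphere 0 1" "p 0 \<bullet> p 0 = 1"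
    using norm_p[of 0] h_pos by (auto simp: norm_eq_1)
  have nonempty: "topspace X \<noteq> {}" using assms(2) surj by auto
  have chart: "\<exists>W :: (real^2) set. open W \<and> subtopology X V homeomorphic_space top_of_set W"
    if S: "subtopology X V homeomorphic_space top_of_set S" "a \<in> sphere 0 1" "a \<notin> S"
      "openin (top_of_set (sphere 0 1)) S" for V S and a :: "real^3"
  proof -
    obtain W :: "(real^2) set" where "open W" "S homeomorphic W"
      using punctured_sphere_open_homeomorphic S(2-4) by blast
    then have "subtopology X V homeomorphic_space top_of_set W"
      using S(1) homeomorphic_space_trans homeomorphic_imp_homeomorphic_space by blast
    then show ?thesis using \<open>open W\<close> by blast
  qed
  have "\<exists>U. openin X U \<and> z \<in> U \<and>
      (\<exists>W :: (real^2) set. open W \<and> subtopology X U homeomorphic_space top_of_set W)"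
    if z: "z \<in> topspace X" for z
  proof -
    obtain x where x: "x \<in> Y" "z = glue x" using z surj by auto
    then have nx: "norm x = 1" by (simp add: mem_Y)
    have collar: ?thesis if "i < h" "x' \<in> Y" "p (2 * i) \<bullet> x' = c" "z = glue x'" for i x'
    proof -
      obtain V where V: "openin X V" "\<And>x. \<lbrakk>x \<in> Y; c0 < p (2 * i) \<bullet> x\<rbrakk> \<Longrightarrow> glue x \<in> V"
        "subtopology X V homeomorphic_space top_of_set (zone (p (2 * i)) c0)"
        using collar_chart[OF q \<open>i < h\<close>] by blast
      have "z \<in> V" using V(2)[of x'] that c_bounds by simp
      have n: "norm (p (2 * i)) = 1" using \<open>i < h\<close> by (simp add: norm_p)
      have "zone (p (2 * i)) c0 = sphere 0 1 \<inter> ({y. c0 < p (2 * i) \<bullet> y} \<inter> {y. p (2 * i) \<bullet> y < 1})"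
        by (auto simp: zone_def)
      then have "openin (top_of_set (sphere 0 1)) (zone (p (2 * i)) c0)"
        by (simp add: open_Int open_halfspace_gt open_halfspace_lt openin_open_Int)
      then show ?thesis
        using chart[OF V(3), of "p (2 * i)"] n V(1) \<open>z \<in> V\<close> by (auto simp: zone_def norm_eq_1)
    qed
    show ?thesis
    proof (cases "\<exists>k<2 * h. p k \<bullet> x = c")
      case True
      then obtain k where k: "k < 2 * h" "p k \<bullet> x = c" by blast
      show ?thesis
      proof (cases "even k")
        case True
        then obtain i where "k = 2 * i" by (rule evenE)
        then show ?thesis using collar[of i x] k x by simp
      next
        case False
        then obtain i where i: "k = Suc (2 * i)" by (auto elim: oddE)
        then have ih: "i < h" using k by simp
        \<comment> \<open>The mirror image on the even circle represents the same point of
          \<open>X\<close>, so the collar chart of pair \<open>i\<close> applies.\<close>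
        have px: "p (2 * i) \<bullet> sw i x = c" using k i ih by (simp add: sw_inner)
        have n: "norm (sw i x) = 1" by (simp add: swap_reflection_norm nx)
        have "sw i x \<in> Y"
          using px n ih c_bounds by (intro mem_Y_I[of "2 * i"]) auto
        moreover have "z = glue (sw i x)"
        proof -
          have "glue x = sw i x" using k i ih nx by (intro glue_odd) auto
          moreover have "glue (sw i x) = sw i x" using px n ih c_bounds by (intro glue_even[of i]) auto
          ultimately show ?thesis using x by simp
        qed
        ultimately show ?thesis using collar[OF ih _ px] by blast
      qed
    next
      case False
      then have "\<forall>i<2 * h. p i \<bullet> x < c"
        using x by (auto simp: mem_Y order.strict_iff_order)
      then have V: "x \<in> {y. norm y = 1 \<and> (\<forall>i<2 * h. p i \<bullet> y < c)}" using nx by blast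
      moreover have "glue x = x" using False by (intro glue_other) auto
      \<comment> \<open>\<open>p 0\<close> is the centre of a removed cap, so it can serve as the
        puncture.\<close>
      moreover have "p 0 \<notin> {y. norm y = 1 \<and> (\<forall>i<2 * h. p i \<bullet> y < c)}"
      proof
        assume "p 0 \<in> {y. norm y = 1 \<and> (\<forall>i<2 * h. p i \<bullet> y < c)}"
        then have "p 0 \<bullet> p 0 < c" using h_pos by simp
        then show False using p0 c_bounds by simp
      qed
      ultimately show ?thesis
        using chart[OF flat_chart(2)[OF q] p0(1) _ flat_chart(3)[OF q]] flat_chart(1)[OF q] x(2)
        by (intro exI[of _ "{y. norm y = 1 \<and> (\<forall>i<2 * h. p i \<bullet> y < c)}"]) simp
    qed
  qed
  then show "surface X"
    unfolding surface_def using nonempty comp conn haus by blast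

  have "disjoint_caps (2 * h) p (\<lambda>_. c)"
    unfolding disjoint_caps_def using norm_p c_bounds cap_unique
    by (fastforce simp: disjoint_iff)
  moreover have "glue x = glue y \<longleftrightarrow> x = y \<or>
             (\<exists>i<h. (x \<in> rim (p (2 * i)) c \<and> y = swap_reflection (p (2 * i)) (p (2 * i + 1)) x) \<or>
                    (y \<in> rim (p (2 * i)) c \<and> x = swap_reflection (p (2 * i)) (p (2 * i + 1)) y))"
    if "x \<in> Y" "y \<in> Y" for x y
  proof -
    have n: "norm x = 1" "norm y = 1" using that by (auto simp: mem_Y)
    show ?thesis
      unfolding glue_eq_iff[OF n] glued_def using n by (auto simp: rim_def)
  qed
  ultimately show "sphere_with_handles h X"
    unfolding sphere_with_handles_def using q unfolding Y_def
    by (intro exI[of _ p] exI[of _ "\<lambda>_. c"] exI[of _ glue]) simp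
qed

end

section \<open>Chords and caps on the equator\<close>

text \<open>If a unit vector has height at least \<open>c0\<close> over two centres, then
  \<open>2 * c0\<close> is at most the norm of their sum, whose square
  \<open>2 + 2 * (p i \<bullet> p j)\<close> is at most \<open>2 + 2 * \<mu>\<close> with
  \<open>\<mu> < 1\<close> bounding the inner products.\<close>

lemma exists_disjoint_caps:
  fixes p :: "nat \<Rightarrow> 'a::real_inner"
  assumes norm_p: "\<And>i. i < m \<Longrightarrow> norm (p i) = 1" and inj: "inj_on p {..<m}"
  obtains c0 where "0 \<le> c0" "c0 < 1"
    "\<And>i j x. \<lbrakk>i < m; j < m; i \<noteq> j; norm x = 1; c0 \<le> p i \<bullet> x\<rbrakk> \<Longrightarrow> p j \<bullet> x < c0"
proof -
  \<comment> \<open>The inserted 0 keeps the set nonempty and gives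
    \<open>0 \<le> \<mu>\<close>.\<close>
  let ?S = "insert 0 ((\<lambda>(i, j). p i \<bullet> p j) ` {(i, j). i < m \<and> j < m \<and> i \<noteq> j})"
  define \<mu> where "\<mu> = Max ?S"
  have "{(i, j). i < m \<and> j < m \<and> i \<noteq> j} \<subseteq> {..<m} \<times> {..<m}" by auto
  then have "finite {(i, j). i < m \<and> j < m \<and> i \<noteq> j}"
    using finite_subset by blast
  then have fin: "finite ?S" by simp
  have "p i \<bullet> p j < 1" if "i < m" "j < m" "i \<noteq> j" for i j
  proof -
    have "p i \<noteq> p j" using inj that by (auto simp: inj_on_def)
    then have "0 < (p i - p j) \<bullet> (p i - p j)" by simp
    then show ?thesis
      using norm_p[of i] norm_p[of j] that
      by (simp add: inner_diff_left inner_diff_right inner_commute norm_eq_1)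
  qed
  then have \<mu>: "0 \<le> \<mu>" "\<mu> < 1"
    using fin by (auto simp: \<mu>_def)
  have le_\<mu>: "p i \<bullet> p j \<le> \<mu>" if "i < m" "j < m" "i \<noteq> j" for i j
    unfolding \<mu>_def by (rule Max_ge[OF fin]) (use that in auto)
  \<comment> \<open>The square of \<open>c0\<close> is midway between the critical value
    \<open>(1 + \<mu>) / 2\<close> and 1, so that its fourfold exceeds
    \<open>2 + 2 * \<mu>\<close>.\<close>
  define c0 where "c0 = sqrt ((3 + \<mu>) / 4)"
  have c0: "0 \<le> c0" "c0 < 1" "c0\<^sup>2 = (3 + \<mu>) / 4" using \<mu> by (auto simp: c0_def)
  have "p j \<bullet> x < c0" if ij: "i < m" "j < m" "i \<noteq> j" and x: "norm x = 1" "c0 \<le> p i \<bullet> x" for i j x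
  proof (rule ccontr)
    assume "\<not> p j \<bullet> x < c0"
    then have "2 * c0 \<le> (p i + p j) \<bullet> x" using x by (simp add: inner_add_left)
    also have "\<dots> \<le> norm (p i + p j)"
      using norm_cauchy_schwarz[of "p i + p j" x] x by simp
    finally have "(2 * c0)\<^sup>2 \<le> (norm (p i + p j))\<^sup>2" using c0 by (intro power_mono) auto
    also have "\<dots> = 2 + 2 * (p i \<bullet> p j)"
      using norm_p[of i] norm_p[of j] ij
      by (simp add: power2_norm_eq_inner inner_add_left inner_add_right inner_commute norm_eq_1)
    finally show False using le_\<mu>[OF ij] c0 \<mu> by (simp add: power_mult_distrib)
  qed
  then show thesis using that c0 by blast
qed

text \<open>Applied in \<open>sw_rim_point\<close>, where \<open>y\<close> is the vertical part of a
  point, which a reflection in a vertical plane fixes.\<close>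

lemma swap_reflection_add_orthogonal:
  assumes "(a - b) \<bullet> y = 0"
  shows "swap_reflection a b (r *\<^sub>R x + y) = r *\<^sub>R swap_reflection a b x + y"
  using assms unfolding swap_reflection_def
  by (simp add: inner_add_right algebra_simps)

section \<open>Chords of a circle\<close>

definition circle_point :: "real \<Rightarrow> real \<Rightarrow> complex" where
  "circle_point r \<alpha> = r *\<^sub>R cis \<alpha>"

lemma cis_inner_circle_point: "cis \<mu> \<bullet> circle_point r \<alpha> = r * cos (\<alpha> - \<mu>)"
  by (simp add: circle_point_def inner_complex_def cos_diff algebra_simps)

lemma norm_circle_point: "0 \<le> r \<Longrightarrow> norm (circle_point r \<alpha>) = r"
  by (simp add: circle_point_def)

text \<open>Angles are confined to a half circle, where the cosine alone determines them.\<close>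

lemma circle_point_inj:
  assumes "0 < r" "circle_point r \<alpha> = circle_point r \<beta>" "\<alpha> \<in> {0..<pi}" "\<beta> \<in> {0..<pi}"
  shows "\<alpha> = \<beta>"
proof -
  have "cos \<alpha> = cos \<beta>" using assms by (auto simp: circle_point_def complex_eq_iff)
  then show ?thesis using assms cos_inj_pi by auto
qed

text \<open>Strict convexity of the ball: the squared norm falls short of \<open>r\<^sup>2\<close>
  by \<open>t * (1 - t)\<close> times the squared length of the chord.\<close>

lemma norm_chord_less:
  fixes x y :: "'a::real_inner"
  assumes "norm x = r" "norm y = r" "x \<noteq> y" "0 < t" "t < 1"
  shows "norm ((1 - t) *\<^sub>R x + t *\<^sub>R y) < r"
proof (rule power2_less_imp_less)
  have "x \<bullet> x = r\<^sup>2" "y \<bullet> y = r\<^sup>2" using assms by (auto simp: dot_square_norm)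
  then have "(norm ((1 - t) *\<^sub>R x + t *\<^sub>R y))\<^sup>2 = r\<^sup>2 - t * (1 - t) * ((x - y) \<bullet> (x - y))"
    unfolding power2_norm_eq_inner
    by (simp add: inner_add_left inner_add_right inner_diff_left inner_diff_right inner_commute)
      (simp add: algebra_simps power2_eq_square)
  moreover have "0 < t * (1 - t) * ((x - y) \<bullet> (x - y))" using assms by simp
  ultimately show "(norm ((1 - t) *\<^sub>R x + t *\<^sub>R y))\<^sup>2 < r\<^sup>2" by linarith
qed (use assms in auto)

text \<open>The linear functional \<open>cis ((\<alpha> + \<beta>) / 2) \<bullet> _\<close> is constant on the chord from \<open>\<alpha>\<close> to \<open>\<beta>\<close>
  and strictly smaller on all other points of the circle outside the arc that the chord cuts off.\<close>

lemma chords_disjoint: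
  assumes r: "0 < r" and ab: "0 \<le> \<alpha>" "\<alpha> < \<beta>" "\<beta> < pi"
    and out: "\<gamma> \<in> {0..<pi} - {\<alpha><..<\<beta>}" "\<delta> \<in> {0..<pi} - {\<alpha><..<\<beta>}"
    and ne: "\<gamma> \<notin> {\<alpha>, \<beta>} \<or> \<delta> \<notin> {\<alpha>, \<beta>}" and t: "0 < t" "t < 1"
  shows "(1 - s) *\<^sub>R circle_point r \<alpha> + s *\<^sub>R circle_point r \<beta>
       \<noteq> (1 - t) *\<^sub>R circle_point r \<gamma> + t *\<^sub>R circle_point r \<delta>"
proof
  assume eq: "(1 - s) *\<^sub>R circle_point r \<alpha> + s *\<^sub>R circle_point r \<beta>
       = (1 - t) *\<^sub>R circle_point r \<gamma> + t *\<^sub>R circle_point r \<delta>"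
  define \<mu> where "\<mu> = (\<alpha> + \<beta>) / 2"
  define \<kappa> where "\<kappa> = r * cos ((\<beta> - \<alpha>) / 2)"
  have L: "cis \<mu> \<bullet> circle_point r \<theta> < \<kappa>"
    if "\<theta> \<in> {0..<pi} - {\<alpha><..<\<beta>}" "\<theta> \<notin> {\<alpha>, \<beta>}" for \<theta>
  proof -
    \<comment> \<open>\<open>\<mu>\<close> is the middle of the arc. Angles outside the arc differ
      from it by more than half the arc and at most \<open>pi\<close>, a range on which the cosine
      decreases strictly.\<close>
    have "(\<beta> - \<alpha>) / 2 < \<bar>\<theta> - \<mu>\<bar>" "\<bar>\<theta> - \<mu>\<bar> \<le> pi"
      using that ab by (auto simp: \<mu>_def abs_if field_simps)
    then have "cos \<bar>\<theta> - \<mu>\<bar> < cos ((\<beta> - \<alpha>) / 2)"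
      using ab by (intro cos_monotone_0_pi) auto
    then show ?thesis using r by (simp add: cis_inner_circle_point \<kappa>_def)
  qed
  have "\<alpha> - \<mu> = - ((\<beta> - \<alpha>) / 2)" "\<beta> - \<mu> = (\<beta> - \<alpha>) / 2"
    by (simp_all add: \<mu>_def field_simps)
  then have Lab: "cis \<mu> \<bullet> circle_point r \<alpha> = \<kappa>" "cis \<mu> \<bullet> circle_point r \<beta> = \<kappa>"
    by (simp_all only: cis_inner_circle_point \<kappa>_def cos_minus)
  have le: "cis \<mu> \<bullet> circle_point r \<gamma> \<le> \<kappa>" "cis \<mu> \<bullet> circle_point r \<delta> \<le> \<kappa>"
    using L[OF out(1)] L[OF out(2)] Lab by fastforce+
  have lt: "cis \<mu> \<bullet> circle_point r \<gamma> < \<kappa> \<or> cis \<mu> \<bullet> circle_point r \<delta> < \<kappa>"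
    using L out ne by blast
  have "\<kappa> = cis \<mu> \<bullet> ((1 - s) *\<^sub>R circle_point r \<alpha> + s *\<^sub>R circle_point r \<beta>)"
    using Lab by (simp add: inner_add_right algebra_simps)
  also have "\<dots> = (1 - t) * (cis \<mu> \<bullet> circle_point r \<gamma>) + t * (cis \<mu> \<bullet> circle_point r \<delta>)"
    unfolding eq by (simp add: inner_add_right)
  also have "\<dots> < (1 - t) * \<kappa> + t * \<kappa>"
    using lt
  proof
    assume "cis \<mu> \<bullet> circle_point r \<gamma> < \<kappa>"
    then show ?thesis using le t by (intro add_less_le_mono) auto
  next
    assume "cis \<mu> \<bullet> circle_point r \<delta> < \<kappa>"
    then show ?thesis using le t by (intro add_le_less_mono) auto
  qed
  finally show False by (simp add: algebra_simps)
qed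

section \<open>Projection to the equatorial disc\<close>

text \<open>The inverse of the orthogonal projection from the upper (\<open>\<sigma> = 1\<close>) or
  lower (\<open>\<sigma> = -1\<close>) hemisphere onto the unit disc.\<close>

definition lift_disc :: "real \<Rightarrow> complex \<Rightarrow> real^3" where
  "lift_disc \<sigma> z = Re z *\<^sub>R axis 1 1 + Im z *\<^sub>R axis 2 1 + (\<sigma> * sqrt (1 - (norm z)\<^sup>2)) *\<^sub>R axis 3 1"

definition equator_point :: "real \<Rightarrow> real^3" where
  "equator_point \<theta> = cos \<theta> *\<^sub>R axis 1 1 + sin \<theta> *\<^sub>R axis 2 1"

lemma continuous_on_lift_disc: "continuous_on S (lift_disc \<sigma>)"
  unfolding lift_disc_def by (intro continuous_intros)

lemma lift_disc_nth:
  "lift_disc \<sigma> z $ 1 = Re z" "lift_disc \<sigma> z $ 2 = Im z" "lift_disc \<sigma> z $ 3 = \<sigma> * sqrt (1 - (norm z)\<^sup>2)"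
  by (simp_all add: lift_disc_def axis_def)

lemma lift_disc_inj: "lift_disc \<sigma> z = lift_disc \<sigma> w \<Longrightarrow> z = w"
  by (metis complex_eq_iff lift_disc_nth(1,2))

lemma norm_equator_point: "norm (equator_point \<theta>) = 1"
  unfolding norm_eq_1 equator_point_def
  by (simp add: inner_add_left inner_add_right inner_axis_axis flip: power2_eq_square)

text \<open>A cap centred on the equator projects to the part of the disc in a half plane, so
  heights over caps can be read off in the plane.\<close>

lemma equator_point_inner_lift: "equator_point \<theta> \<bullet> lift_disc \<sigma> z = cis \<theta> \<bullet> z"
  unfolding lift_disc_def equator_point_def
  by (simp add: inner_add_left inner_add_right inner_axis_axis inner_complex_def)

lemma norm_lift_disc:
  assumes "norm z \<le> 1" "\<sigma>\<^sup>2 = 1"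
  shows "norm (lift_disc \<sigma> z) = 1"
proof -
  have "(norm z)\<^sup>2 \<le> 1" using assms by (simp add: power_le_one)
  then have "lift_disc \<sigma> z \<bullet> lift_disc \<sigma> z = (Re z)\<^sup>2 + (Im z)\<^sup>2 + \<sigma>\<^sup>2 * (1 - (norm z)\<^sup>2)"
    unfolding lift_disc_def
    by (simp add: inner_add_left inner_add_right inner_axis_axis power2_eq_square)
  then show ?thesis using assms by (simp add: norm_eq_1 cmod_power2)
qed

lemma sphere_eq_lift_disc:
  assumes "norm (x :: real^3) = 1"
  obtains \<sigma> z where "norm z \<le> 1" "\<sigma> = 1 \<or> \<sigma> = -1" "x = lift_disc \<sigma> z"
proof -
  define z where "z = Complex (x $ 1) (x $ 2)"
  have n: "(x $ 1)\<^sup>2 + (x $ 2)\<^sup>2 + (x $ 3)\<^sup>2 = 1"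
    using assms by (simp add: norm_eq_1 inner_vec_def sum_3 power2_eq_square)
  then have z: "1 - (norm z)\<^sup>2 = (x $ 3)\<^sup>2" by (simp add: z_def cmod_power2)
  then have "(norm z)\<^sup>2 \<le> 1\<^sup>2" by (smt (verit) zero_le_power2 one_power2)
  then have "norm z \<le> 1" by (rule power2_le_imp_le) simp
  define \<sigma> where "\<sigma> = (if 0 \<le> x $ 3 then 1 else -1 :: real)"
  have "\<sigma> * sqrt (1 - (norm z)\<^sup>2) = x $ 3" using z by (simp add: \<sigma>_def)
  then have "x = lift_disc \<sigma> z"
    by (simp add: vec_eq_iff forall_3 lift_disc_nth) (simp add: z_def)
  moreover have "\<sigma> = 1 \<or> \<sigma> = -1" by (simp add: \<sigma>_def)
  ultimately show thesis using that \<open>norm z \<le> 1\<close> by blast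
qed

section \<open>Caps centred on the equator\<close>

locale equatorial_caps = capped_sphere +
  fixes \<theta> :: "nat \<Rightarrow> real"
  assumes p_eq: "k < 2 * h \<Longrightarrow> p k = equator_point (\<theta> k)"
    and \<theta>_range: "k < 2 * h \<Longrightarrow> \<theta> k \<in> {0..<pi}"
    and c0_nonneg: "0 \<le> c0"
begin

lemma c_pos: "0 < c"
  using c_bounds c0_nonneg by simp

lemma p_inner_lift: "k < 2 * h \<Longrightarrow> p k \<bullet> lift_disc \<sigma> z = cis (\<theta> k) \<bullet> z"
  by (simp add: p_eq equator_point_inner_lift)

text \<open>Each hemisphere of \<open>Y\<close> is the lift of the convex set \<open>P\<close>, a
  disc with half planes cut off, and the two lifts meet on the equator at the lift of
  \<open>- \<i>\<close>.\<close>

lemma connected_Y: "connected Y" and Y_nonempty: "Y \<noteq> {}"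
proof -
  define P where "P = cball 0 1 \<inter> (\<Inter>k<2 * h. {z. cis (\<theta> k) \<bullet> z \<le> c})"
  have lift_Y: "lift_disc \<sigma> z \<in> Y \<longleftrightarrow> z \<in> P" if "norm z \<le> 1" "\<sigma> = 1 \<or> \<sigma> = -1" for \<sigma> z
    using that by (auto simp: mem_Y P_def p_inner_lift norm_lift_disc)
  have Y_eq: "Y = lift_disc 1 ` P \<union> lift_disc (-1) ` P"
  proof
    show "Y \<subseteq> lift_disc 1 ` P \<union> lift_disc (-1) ` P"
    proof
      fix x assume x: "x \<in> Y"
      then have "norm x = 1" by (simp add: mem_Y)
      then obtain \<sigma> z where "norm z \<le> 1" "\<sigma> = 1 \<or> \<sigma> = -1" "x = lift_disc \<sigma> z"
        by (rule sphere_eq_lift_disc)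
      then show "x \<in> lift_disc 1 ` P \<union> lift_disc (-1) ` P" using lift_Y x by auto
    qed
    show "lift_disc 1 ` P \<union> lift_disc (-1) ` P \<subseteq> Y"
      using lift_Y by (auto simp: P_def)
  qed
  have "convex P"
    unfolding P_def by (intro convex_Int convex_INT convex_cball convex_halfspace_le)
  then have "connected P" by (rule convex_connected)
  then have conn: "connected (lift_disc \<sigma> ` P)" for \<sigma>
    by (rule connected_continuous_image[OF continuous_on_lift_disc])
  \<comment> \<open>All centres have angles in \<open>{0..<pi}\<close>, so the height of this point
    over each cap is at most 0.\<close>
  have "cis (\<theta> k) \<bullet> - \<i> \<le> c" if "k < 2 * h" for k
  proof -
    have "0 \<le> sin (\<theta> k)" using \<theta>_range[OF that] by (intro sin_ge_zero) auto
    then show ?thesis using c_pos by (simp add: inner_complex_def)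
  qed
  then have "- \<i> \<in> P" by (auto simp: P_def)
  moreover have "lift_disc 1 (- \<i>) = lift_disc (-1) (- \<i>)" by (simp add: lift_disc_def)
  ultimately have "lift_disc 1 ` P \<inter> lift_disc (-1) ` P \<noteq> {}" by blast
  then show "connected Y" "Y \<noteq> {}"
    unfolding Y_eq using connected_Un conn by blast+
qed

text \<open>By Cauchy-Schwarz the disc of radius \<open>c\<close> stays out of every removed cap, so
  a drawing in that disc lifts to \<open>Y\<close>.\<close>

lemma lift_mem_Y:
  assumes "norm z \<le> c"
  shows "lift_disc 1 z \<in> Y"
proof -
  have "cis (\<theta> k) \<bullet> z \<le> c" for k
    using norm_cauchy_schwarz[of "cis (\<theta> k)" z] assms by simp
  then show ?thesis using assms c_bounds by (simp add: mem_Y p_inner_lift norm_lift_disc)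
qed

text \<open>Equality case of Cauchy-Schwarz: the rim of a cap projects to a chord of the unit disc
  that is tangent to the circle of radius \<open>c\<close>, and touches it at the projection of the
  top of the rim.\<close>

lemma rim_point:
  assumes "norm z \<le> c" "k < 2 * h" "p k \<bullet> lift_disc 1 z = c"
  shows "z = circle_point c (\<theta> k)"
proof -
  have "cis (\<theta> k) \<bullet> z = c" using assms by (simp add: p_inner_lift)
  then have "z \<bullet> circle_point c (\<theta> k) = c * c"
    by (simp add: circle_point_def inner_commute)
  moreover have "circle_point c (\<theta> k) \<bullet> circle_point c (\<theta> k) = c * c"
    using c_pos norm_circle_point[of c "\<theta> k"] by (simp add: dot_square_norm power2_eq_square)
  moreover have "z \<bullet> z \<le> c * c"
    using power_mono[OF assms(1), of 2] by (simp add: dot_square_norm power2_eq_square)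
  ultimately have "(z - circle_point c (\<theta> k)) \<bullet> (z - circle_point c (\<theta> k)) \<le> 0"
    by (simp add: inner_diff_left inner_diff_right inner_commute)
  then show ?thesis by (metis eq_iff_diff_eq_0 inner_eq_zero_iff inner_ge_zero order_antisym)
qed

text \<open>Both tops have the vertical coordinate \<open>sqrt (1 - c\<^sup>2)\<close>; the
  reflection fixes the vertical part and exchanges the centres.\<close>

lemma sw_rim_point:
  assumes "i < h"
  shows "sw i (lift_disc 1 (circle_point c (\<theta> (2 * i)))) = lift_disc 1 (circle_point c (\<theta> (Suc (2 * i))))"
proof -
  have k: "2 * i < 2 * h" "Suc (2 * i) < 2 * h" using assms by auto
  have l: "lift_disc 1 (circle_point c \<alpha>) = c *\<^sub>R equator_point \<alpha> + sqrt (1 - c\<^sup>2) *\<^sub>R axis 3 1" for \<alpha>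
    using c_pos by (simp add: lift_disc_def norm_circle_point equator_point_def)
      (simp add: circle_point_def algebra_simps)
  have "(p (2 * i) - p (Suc (2 * i))) \<bullet> (sqrt (1 - c\<^sup>2) *\<^sub>R axis 3 1) = 0"
    using k by (simp add: p_eq equator_point_def inner_diff_left inner_add_left inner_axis_axis)
  then show ?thesis
    unfolding l using swap_reflection_left[OF norm_p[OF k(1)] norm_p[OF k(2)]] k
    by (simp add: swap_reflection_add_orthogonal p_eq)
qed

text \<open>The disc of radius \<open>c\<close> meets each rim in its top only, so in a drawing
  there nothing but paired tops is identified.\<close>

lemma glue_lift_eq:
  assumes "norm z \<le> c" "norm z' \<le> c" "glue (lift_disc 1 z) = glue (lift_disc 1 z')"
  shows "z = z' \<or> (\<exists>i<h. {z, z'} = {circle_point c (\<theta> (2 * i)), circle_point c (\<theta> (Suc (2 * i)))})"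
proof -
  have *: "\<exists>i<h. z = circle_point c (\<theta> (2 * i)) \<and> z' = circle_point c (\<theta> (Suc (2 * i)))"
    if "glued (lift_disc 1 z) (lift_disc 1 z')" "norm z \<le> c" for z z'
  proof -
    obtain i where i: "i < h" "p (2 * i) \<bullet> lift_disc 1 z = c" "lift_disc 1 z' = sw i (lift_disc 1 z)"
      using \<open>glued _ _\<close> unfolding glued_def by blast
    have z: "z = circle_point c (\<theta> (2 * i))" using i that by (intro rim_point) auto
    then have "z' = circle_point c (\<theta> (Suc (2 * i)))"
      using i sw_rim_point by (intro lift_disc_inj[of 1]) simp
    then show ?thesis using i z by blast
  qed
  have "norm (lift_disc 1 z) = 1" "norm (lift_disc 1 z') = 1"
    using assms c_bounds by (auto simp: norm_lift_disc)
  then have "lift_disc 1 z = lift_disc 1 z' \<or> glued (lift_disc 1 z) (lift_disc 1 z')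
      \<or> glued (lift_disc 1 z') (lift_disc 1 z)"
    using glue_eq_iff assms by blast
  then show ?thesis
  proof (elim disjE)
    assume "glued (lift_disc 1 z) (lift_disc 1 z')"
    then show ?thesis using *[of z z'] assms by blast
  next
    assume "glued (lift_disc 1 z') (lift_disc 1 z)"
    then show ?thesis using *[of z' z] assms by (metis insert_commute)
  qed (use lift_disc_inj in blast)
qed

lemma glue_rim_point:
  assumes "i < h"
  shows "glue (lift_disc 1 (circle_point c (\<theta> (2 * i)))) = glue (lift_disc 1 (circle_point c (\<theta> (Suc (2 * i)))))"
proof -
  have k: "2 * i < 2 * h" using assms by auto
  have n: "norm (lift_disc 1 (circle_point c \<alpha>)) = 1" for \<alpha>
    using c_pos c_bounds by (simp add: norm_lift_disc norm_circle_point)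
  have "p (2 * i) \<bullet> lift_disc 1 (circle_point c (\<theta> (2 * i))) = c"
    using k by (simp add: p_inner_lift cis_inner_circle_point)
  then have "glued (lift_disc 1 (circle_point c (\<theta> (2 * i)))) (lift_disc 1 (circle_point c (\<theta> (Suc (2 * i)))))"
    unfolding glued_def using sw_rim_point assms by metis
  then show ?thesis using glue_eq_iff n by blast
qed

end

section \<open>One handle for each edge\<close>

text \<open>The half circle is divided into \<open>n * Suc h\<close> slots. Vertex \<open>v\<close>
  owns a block of \<open>Suc h\<close> of them: the first, \<open>v * Suc h\<close>, is its own
  place, and \<open>v * Suc h + Suc i\<close> is reserved for the \<open>v\<close>-end of edge
  \<open>i\<close>, whether or not \<open>v\<close> is an end of it.\<close>

locale handle_graph = equatorial_caps +
  fixes n :: nat and u w :: "nat \<Rightarrow> nat"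
  assumes edge: "i < h \<Longrightarrow> u i < w i" "i < h \<Longrightarrow> w i < n"
    and \<theta>_even: "i < h \<Longrightarrow> \<theta> (2 * i) = pi * real (u i * Suc h + Suc i) / real (n * Suc h)"
    and \<theta>_odd: "i < h \<Longrightarrow> \<theta> (Suc (2 * i)) = pi * real (w i * Suc h + Suc i) / real (n * Suc h)"
begin

section \<open>Half edges as chords\<close>

definition slot :: "nat \<Rightarrow> real" where
  "slot k = pi * real k / real (n * Suc h)"

text \<open>The straight segment from vertex \<open>v\<close> to the top of the cap at the \<open>v\<close>-end of edge \<open>i\<close>.\<close>

definition half_edge :: "nat \<Rightarrow> nat \<Rightarrow> real \<Rightarrow> complex" where
  "half_edge v i s = (1 - s) *\<^sub>R circle_point c (slot (v * Suc h))
     + s *\<^sub>R circle_point c (slot (v * Suc h + Suc i))"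

lemma slot_less: "slot j < slot k \<longleftrightarrow> j < k" if "0 < n"
proof -
  have "0 < real (n * Suc h)" using that by (metis of_nat_0_less_iff nat_0_less_mult_iff zero_less_Suc)
  then show ?thesis
    by (auto simp: slot_def divide_less_cancel simp del: mult_Suc_right of_nat_mult)
qed

lemma slot_range: "slot k \<in> {0..<pi}" if "k < n * Suc h"
  using that unfolding slot_def by (simp add: divide_less_eq del: mult_Suc_right of_nat_mult)

lemma vertex_slot: "v < n \<Longrightarrow> k \<le> h \<Longrightarrow> v * Suc h + k < n * Suc h"
proof -
  assume "v < n" "k \<le> h"
  then have "v * Suc h + k < Suc v * Suc h" by simp
  also have "\<dots> \<le> n * Suc h" using \<open>v < n\<close> by (intro mult_le_mono1) simp
  finally show ?thesis .
qed

lemma slot_eq: "v * Suc h + k = v' * Suc h + k' \<longleftrightarrow> v = v' \<and> k = k'" if "k \<le> h" "k' \<le> h"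
proof
  assume eq: "v * Suc h + k = v' * Suc h + k'"
  have "(v * Suc h + k) div Suc h = v" "(v' * Suc h + k') div Suc h = v'"
    using that by (simp_all add: div_mult_self3 del: mult_Suc mult_Suc_right)
  then have "v = v'" using eq by metis
  then show "v = v' \<and> k = k'" using eq by simp
qed simp

lemma circle_slot_eq:
  assumes "v < n" "v' < n" "k \<le> h" "k' \<le> h"
    "circle_point c (slot (v * Suc h + k)) = circle_point c (slot (v' * Suc h + k'))"
  shows "v = v' \<and> k = k'"
proof -
  have "slot (v * Suc h + k) = slot (v' * Suc h + k')"
    using circle_point_inj[OF c_pos assms(5)] slot_range vertex_slot assms(1-4) by blast
  then have "v * Suc h + k = v' * Suc h + k'"
    using slot_less assms(1) by (metis less_irrefl linorder_neqE_nat not_less_zero gr0I)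
  then show ?thesis using slot_eq assms by simp
qed

lemma half_edge_ends:
  "half_edge v i 0 = circle_point c (slot (v * Suc h + 0))"
  "half_edge v i 1 = circle_point c (slot (v * Suc h + Suc i))"
  by (simp_all add: half_edge_def)

lemma ends_ne:
  "\<lbrakk>v < n; i < h\<rbrakk> \<Longrightarrow> circle_point c (slot (v * Suc h)) \<noteq> circle_point c (slot (v * Suc h + Suc i))"
  using circle_slot_eq[of v v 0 "Suc i"] by auto

lemma norm_half_edge_less:
  assumes "v < n" "i < h" "0 < s" "s < 1"
  shows "norm (half_edge v i s) < c"
  unfolding half_edge_def using assms ends_ne c_pos
  by (intro norm_chord_less) (auto simp: norm_circle_point)

lemma norm_half_edge_le:
  assumes "v < n" "i < h" "s \<in> {0..1}"
  shows "norm (half_edge v i s) \<le> c"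
proof -
  consider "s = 0" | "s = 1" | "0 < s" "s < 1" using assms by force
  then show ?thesis
    using norm_half_edge_less[OF assms(1,2)] c_pos
    by cases (auto simp: half_edge_ends norm_circle_point less_imp_le)
qed

text \<open>Interior points of a chord are strictly inside the circle, so only its two ends can be
  met there.\<close>

lemma half_edge_on_circle:
  assumes "v < n" "i < h" "s \<in> {0..1}" "v' < n" "k \<le> h"
    "half_edge v i s = circle_point c (slot (v' * Suc h + k))"
  shows "v = v' \<and> (s = 0 \<and> k = 0 \<or> s = 1 \<and> k = Suc i)"
proof -
  have "norm (half_edge v i s) = c" using assms c_pos by (simp add: norm_circle_point)
  then have "\<not> (0 < s \<and> s < 1)" using norm_half_edge_less[OF assms(1,2), of s] by auto
  then have "s = 0 \<or> s = 1" using assms(3) by auto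
  then show ?thesis
  proof (elim disjE)
    assume s: "s = 0"
    then have "circle_point c (slot (v * Suc h + 0)) = circle_point c (slot (v' * Suc h + k))"
      using s assms(6) half_edge_ends(1) by metis
    from circle_slot_eq[OF assms(1,4) _ assms(5) this] show ?thesis using s by simp
  next
    assume s: "s = 1"
    then have "circle_point c (slot (v * Suc h + Suc i)) = circle_point c (slot (v' * Suc h + k))"
      using s assms(6) half_edge_ends(2) by metis
    from circle_slot_eq[OF assms(1,4) _ assms(5) this] show ?thesis using s assms(2) by simp
  qed
qed

text \<open>Both ends of the later half edge avoid the open arc cut off by the earlier one: a later
  vertex lies beyond the whole block of \<open>v\<close>, and at the same vertex a later edge ends
  at a later slot. Hence \<open>chords_disjoint\<close> applies to interior points.\<close>

lemma half_edges_cross_aux: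
  assumes v: "v < n" "i < h" and v': "v' < n" "i' < h" and s: "s \<in> {0..1}" "s' \<in> {0..1}"
    and eq: "half_edge v i s = half_edge v' i' s'"
    and less: "v < v' \<or> v = v' \<and> i < i'"
  shows "v = v' \<and> s = 0 \<and> s' = 0"
proof -
  consider "s' = 0" | "s' = 1" | "0 < s'" "s' < 1" using s by force
  then show ?thesis
  proof cases
    case 1
    then show ?thesis using half_edge_on_circle[OF v s(1) v'(1), of 0] eq by (simp add: half_edge_ends)
  next
    case 2
    then show ?thesis using half_edge_on_circle[OF v s(1) v'(1), of "Suc i'"] eq less v'
      by (auto simp: half_edge_ends)
  next
    case 3
    have n0: "0 < n" using v by simp
    let ?a = "v * Suc h" and ?b = "v * Suc h + Suc i"
      and ?d = "v' * Suc h" and ?e = "v' * Suc h + Suc i'"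
    have le: "?a = ?d \<or> ?b < ?d" "?b < ?e"
    proof -
      have "?b < ?d" if "v < v'"
      proof -
        have "?b < Suc v * Suc h" using v by simp
        also have "\<dots> \<le> ?d" using that by (intro mult_le_mono1) simp
        finally show ?thesis .
      qed
      then show "?a = ?d \<or> ?b < ?d" "?b < ?e" using less by auto
    qed
    have "?a < n * Suc h" "?b < n * Suc h" "?d < n * Suc h" "?e < n * Suc h"
      using vertex_slot[of v 0] vertex_slot[of v "Suc i"] vertex_slot[of v' 0] vertex_slot[of v' "Suc i'"] v v'
      by simp_all
    then have ran: "slot ?a \<in> {0..<pi}" "slot ?b \<in> {0..<pi}" "slot ?d \<in> {0..<pi}" "slot ?e \<in> {0..<pi}"
      by (blast intro: slot_range)+
    have ab: "slot ?a < slot ?b" using slot_less[OF n0] by simp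
    have be: "slot ?b < slot ?e" using slot_less[OF n0] le by blast
    have d: "slot ?d = slot ?a \<or> slot ?b < slot ?d" using slot_less[OF n0] le by metis
    have "half_edge v i s \<noteq> half_edge v' i' s'"
      unfolding half_edge_def
    proof (rule chords_disjoint[OF c_pos])
      show "0 \<le> slot ?a" "slot ?b < pi" using ran by auto
      show "slot ?a < slot ?b" by (rule ab)
      show "slot ?d \<in> {0..<pi} - {slot ?a<..<slot ?b}" using d ran(3) by auto
      show "slot ?e \<in> {0..<pi} - {slot ?a<..<slot ?b}" using be ran(4) by auto
      show "slot ?d \<notin> {slot ?a, slot ?b} \<or> slot ?e \<notin> {slot ?a, slot ?b}" using ab be by auto
    qed (use 3 in auto)
    then show ?thesis using eq by blast
  qed
qed

lemma half_edges_cross: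
  assumes v: "v < n" "i < h" and v': "v' < n" "i' < h" and s: "s \<in> {0..1}" "s' \<in> {0..1}"
    and eq: "half_edge v i s = half_edge v' i' s'"
  shows "v = v' \<and> (i = i' \<and> s = s' \<or> s = 0 \<and> s' = 0)"
proof -
  consider "v < v' \<or> v = v' \<and> i < i'" | "v' < v \<or> v' = v \<and> i' < i" | "v = v'" "i = i'" by linarith
  then show ?thesis
  proof cases
    case 1
    then show ?thesis using half_edges_cross_aux[OF v v' s eq] by blast
  next
    case 2
    then show ?thesis using half_edges_cross_aux[OF v' v s(2,1) eq[symmetric]] by blast
  next
    case 3
    let ?A = "circle_point c (slot (v * Suc h))" and ?B = "circle_point c (slot (v * Suc h + Suc i))"
    have "(s - s') *\<^sub>R (?B - ?A) = 0"
      using eq 3 unfolding half_edge_def by (simp add: algebra_simps)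
    then show ?thesis using ends_ne[OF v] 3 by auto
  qed
qed

section \<open>The edges drawn on the surface\<close>

definition trace :: "nat \<Rightarrow> nat \<Rightarrow> real \<Rightarrow> real^3" where
  "trace v i s = glue (lift_disc 1 (half_edge v i s))"

text \<open>Distinct half edges coincide in the plane only at a common vertex, and the gluing adds
  only the coincidence of the two tops of one edge.\<close>

lemma trace_eq:
  assumes v: "v < n" "i < h" and v': "v' < n" "i' < h" and s: "s \<in> {0..1}" "s' \<in> {0..1}"
    and eq: "trace v i s = trace v' i' s'"
  shows "v = v' \<and> i = i' \<and> s = s' \<or> v = v' \<and> s = 0 \<and> s' = 0 \<or> i = i' \<and> s = 1 \<and> s' = 1"
proof -
  let ?z = "half_edge v i s" and ?z' = "half_edge v' i' s'"
  consider "?z = ?z'"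
    | j where "j < h" "{?z, ?z'} = {circle_point c (\<theta> (2 * j)), circle_point c (\<theta> (Suc (2 * j)))}"
    using glue_lift_eq[OF norm_half_edge_le[OF v s(1)] norm_half_edge_le[OF v' s(2)]] eq
    unfolding trace_def by blast
  then show ?thesis
  proof cases
    case 1
    then show ?thesis using half_edges_cross[OF v v' s] by blast
  next
    case 2
    have th: "\<theta> (2 * j) = slot (u j * Suc h + Suc j)" "\<theta> (Suc (2 * j)) = slot (w j * Suc h + Suc j)"
      using 2(1) \<theta>_even \<theta>_odd by (simp_all add: slot_def)
    have un: "u j < n" "w j < n" using edge[OF 2(1)] by auto
    have A: "s = 1 \<and> i = j" if "?z \<in> {circle_point c (\<theta> (2 * j)), circle_point c (\<theta> (Suc (2 * j)))}"
      using half_edge_on_circle[OF v s(1) un(1), of "Suc j"] half_edge_on_circle[OF v s(1) un(2), of "Suc j"]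
        that 2(1) unfolding th by auto
    have B: "s' = 1 \<and> i' = j" if "?z' \<in> {circle_point c (\<theta> (2 * j)), circle_point c (\<theta> (Suc (2 * j)))}"
      using half_edge_on_circle[OF v' s(2) un(1), of "Suc j"] half_edge_on_circle[OF v' s(2) un(2), of "Suc j"]
        that 2(1) unfolding th by auto
    show ?thesis using A B 2(2) by blast
  qed
qed

lemma trace_joins:
  assumes "i < h"
  shows "trace (u i) i 1 = trace (w i) i 1"
  using glue_rim_point[OF assms] \<theta>_even[OF assms] \<theta>_odd[OF assms]
  by (simp add: trace_def half_edge_ends slot_def)

lemma continuous_trace:
  assumes q: "quotient_map (top_of_set Y) X glue" and v: "v < n" "i < h"
    and g: "continuous_on S g" "g ` S \<subseteq> {0..1}"
  shows "continuous_map (top_of_set S) X (\<lambda>t. trace v i (g t))"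
proof -
  have "continuous_on S (\<lambda>t. half_edge v i (g t))"
    unfolding half_edge_def by (intro continuous_intros g)
  then have "continuous_on S (\<lambda>t. lift_disc 1 (half_edge v i (g t)))"
    using continuous_on_compose2[OF continuous_on_lift_disc[of UNIV]] by blast
  moreover have "lift_disc 1 (half_edge v i (g t)) \<in> Y" if "t \<in> S" for t
    using g that by (intro lift_mem_Y norm_half_edge_le[OF v]) auto
  ultimately have "continuous_map (top_of_set S) (top_of_set Y) (\<lambda>t. lift_disc 1 (half_edge v i (g t)))"
    by (auto simp: continuous_map_in_subtopology)
  from continuous_map_compose[OF this quotient_imp_continuous_map[OF q]]
  show ?thesis unfolding trace_def o_def .
qed

text \<open>The second half edge is run backwards from its top; at \<open>t = 1 / 2\<close> the two
  tops are the same point of the surface.\<close>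

definition edge_path :: "nat \<Rightarrow> real \<Rightarrow> real^3" where
  "edge_path i t = (if t \<le> 1 / 2 then trace (u i) i (2 * t) else trace (w i) i (2 - 2 * t))"

lemma pathin_edge_path:
  assumes q: "quotient_map (top_of_set Y) X glue" and i: "i < h"
  shows "pathin X (edge_path i)"
  unfolding pathin_def edge_path_def
proof (rule continuous_map_cases_le)
  show "continuous_map (subtopology (top_of_set {0..1}) {t \<in> topspace (top_of_set {0..1}). t \<le> 1 / 2}) X
      (\<lambda>t. trace (u i) i (2 * t))"
    using edge[OF i] i unfolding subtopology_subtopology
    by (intro continuous_trace[OF q] continuous_intros) auto
  show "continuous_map (subtopology (top_of_set {0..1}) {t \<in> topspace (top_of_set {0..1}). 1 / 2 \<le> t}) X
      (\<lambda>t. trace (w i) i (2 - 2 * t))"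
    using edge[OF i] i unfolding subtopology_subtopology
    by (intro continuous_trace[OF q] continuous_intros) auto
  show "trace (u i) i (2 * t) = trace (w i) i (2 - 2 * t)" if "t = 1 / 2" for t
    using trace_joins[OF i] by (simp add: that)
qed (auto intro!: continuous_intros)

lemma edge_path_trace:
  assumes "i < h" "t \<in> {0..1}"
  obtains v s where "edge_path i t = trace v i s" "v < n" "s \<in> {0..1}"
    "t \<le> 1 / 2 \<and> v = u i \<and> s = 2 * t \<or> 1 / 2 < t \<and> v = w i \<and> s = 2 - 2 * t"
proof (cases "t \<le> 1 / 2")
  case True
  then show ?thesis using that[of "u i" "2 * t"] assms edge[OF assms(1)] by (simp add: edge_path_def)
next
  case False
  then show ?thesis using that[of "w i" "2 - 2 * t"] assms edge[OF assms(1)] by (simp add: edge_path_def)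
qed

text \<open>Vertices (\<open>s = 0\<close>) correspond to \<open>t\<close> in \<open>{0, 1}\<close>
  and tops (\<open>s = 1\<close>) to \<open>t = 1 / 2\<close>. That a path does not return to its
  start follows from \<open>u i \<noteq> w i\<close>.\<close>

lemma edge_path_eq:
  assumes i: "i < h" "t \<in> {0..1}" and j: "j < h" "t' \<in> {0..1}" and eq: "edge_path i t = edge_path j t'"
  shows "i = j \<and> t = t' \<or> t \<in> {0, 1} \<and> t' \<in> {0, 1} \<and> i \<noteq> j"
proof -
  obtain v s where vs: "edge_path i t = trace v i s" "v < n" "s \<in> {0..1}"
    "t \<le> 1 / 2 \<and> v = u i \<and> s = 2 * t \<or> 1 / 2 < t \<and> v = w i \<and> s = 2 - 2 * t"
    using edge_path_trace[OF i] .
  obtain v' s' where vs': "edge_path j t' = trace v' j s'" "v' < n" "s' \<in> {0..1}"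
    "t' \<le> 1 / 2 \<and> v' = u j \<and> s' = 2 * t' \<or> 1 / 2 < t' \<and> v' = w j \<and> s' = 2 - 2 * t'"
    using edge_path_trace[OF j] .
  have uw: "u i \<noteq> w i" using edge(1)[OF i(1)] by simp
  from trace_eq[OF vs(2) i(1) vs'(2) j(1) vs(3) vs'(3)] eq vs(1) vs'(1)
  consider "v = v'" "i = j" "s = s'" | "v = v'" "s = 0" "s' = 0" | "i = j" "s = 1" "s' = 1"
    by auto
  then show ?thesis
  proof cases
    case 1
    then show ?thesis using vs(4) vs'(4) uw by auto
  next
    case 2
    then show ?thesis using vs(4) vs'(4) uw by (cases "i = j") auto
  next
    case 3
    then show ?thesis using vs(4) vs'(4) by auto
  qed
qed

lemma edge_path_vertex:
  assumes i: "i < h" "t \<in> {0<..<1}" and v': "v' < n"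
  shows "edge_path i t \<noteq> trace v' 0 0"
proof
  assume eq: "edge_path i t = trace v' 0 0"
  have t: "t \<in> {0..1}" using i by auto
  obtain v s where vs: "edge_path i t = trace v i s" "v < n" "s \<in> {0..1}"
    "t \<le> 1 / 2 \<and> v = u i \<and> s = 2 * t \<or> 1 / 2 < t \<and> v = w i \<and> s = 2 - 2 * t"
    using edge_path_trace[OF i(1) t] .
  show False
    using trace_eq[OF vs(2) i(1) v' h_pos vs(3), of 0] eq vs(1,4) i(2) by auto
qed

lemma embeds:
  assumes q: "quotient_map (top_of_set Y) X glue" and V: "V \<subseteq> {..<n}"
    and E: "bij_betw (\<lambda>i. {u i, w i}) {..<h} E"
  shows "embeds_in V E X"
proof -
  define idx where "idx = inv_into {..<h} (\<lambda>i. {u i, w i})"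
  have idx: "idx e < h" "{u (idx e), w (idx e)} = e" if "e \<in> E" for e
    using that E inv_into_into[of e "\<lambda>i. {u i, w i}" "{..<h}"]
      f_inv_into_f[of e "\<lambda>i. {u i, w i}" "{..<h}"] unfolding idx_def bij_betw_def by auto
  \<comment> \<open>All half edges at \<open>v\<close> start in the same point, so the edge index 0
    is an arbitrary choice; it is an edge because \<open>0 < h\<close>.\<close>
  define \<phi> where "\<phi> v = trace v 0 0" for v
  define \<gamma> where "\<gamma> e = edge_path (idx e)" for e
  have tr0: "trace v i 0 = \<phi> v" for v i
    by (simp add: \<phi>_def trace_def half_edge_def)
  have top: "\<phi> ` V \<subseteq> topspace X"
  proof
    fix x assume "x \<in> \<phi> ` V"
    then obtain v where v: "v < n" "x = \<phi> v" using V by auto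
    have "lift_disc 1 (half_edge v 0 0) \<in> Y"
      using v h_pos by (intro lift_mem_Y norm_half_edge_le) auto
    then show "x \<in> topspace X"
      using v quotient_imp_surjective_map[OF q] by (auto simp: \<phi>_def trace_def)
  qed
  have inj: "inj_on \<phi> V"
  proof (rule inj_onI)
    fix v v' assume "v \<in> V" "v' \<in> V" "\<phi> v = \<phi> v'"
    then show "v = v'"
      using trace_eq[of v 0 v' 0 0 0] V h_pos by (auto simp: \<phi>_def)
  qed
  have arcs: "\<forall>e\<in>E. pathin X (\<gamma> e) \<and> inj_on (\<gamma> e) {0..1} \<and> {\<gamma> e 0, \<gamma> e 1} = \<phi> ` e \<and>
               \<gamma> e ` {0<..<1} \<inter> \<phi> ` V = {}"
  proof (intro ballI conjI)
    fix e assume e: "e \<in> E"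
    show "pathin X (\<gamma> e)" unfolding \<gamma>_def using pathin_edge_path[OF q] idx[OF e] by blast
    show "inj_on (\<gamma> e) {0..1}"
      unfolding \<gamma>_def using edge_path_eq idx(1)[OF e] by (blast intro: inj_onI)
    have "\<gamma> e 0 = \<phi> (u (idx e))" "\<gamma> e 1 = \<phi> (w (idx e))"
      by (simp_all add: \<gamma>_def edge_path_def tr0)
    then show "{\<gamma> e 0, \<gamma> e 1} = \<phi> ` e" using idx(2)[OF e] by (metis image_empty image_insert)
    show "\<gamma> e ` {0<..<1} \<inter> \<phi> ` V = {}"
      using edge_path_vertex[OF idx(1)[OF e]] V unfolding \<gamma>_def \<phi>_def by blast
  qed
  have disj: "\<forall>e\<in>E. \<forall>e'\<in>E. e \<noteq> e' \<longrightarrow> \<gamma> e ` {0<..<1} \<inter> \<gamma> e' ` {0<..<1} = {}"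
  proof (intro ballI impI)
    fix e e' assume e: "e \<in> E" "e' \<in> E" "e \<noteq> e'"
    then have "idx e \<noteq> idx e'" using idx(2) by metis
    then have "\<gamma> e t \<noteq> \<gamma> e' t'" if "t \<in> {0<..<1}" "t' \<in> {0<..<1}" for t t'
      using edge_path_eq[OF idx(1)[OF e(1)] _ idx(1)[OF e(2)], of t t'] that
      unfolding \<gamma>_def by fastforce
    then show "\<gamma> e ` {0<..<1} \<inter> \<gamma> e' ` {0<..<1} = {}" by blast
  qed
  show ?thesis
    unfolding embeds_in_def
    by (rule exI[of _ \<phi>], rule exI[of _ \<gamma>], rule conjI[OF top conjI[OF inj conjI[OF arcs disj]]])
qed

end

section \<open>Every graph with an edge embeds with one handle per edge\<close>

theorem embeddable_with_handle_per_edge: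
  fixes V :: "nat set"
  assumes G: "simple_graph V E" and "E \<noteq> {}"
  shows "embeddable_with_euler_genus V E (2 * card E)"
proof -
  define h where "h = card E"
  have "finite V" "E \<subseteq> Pow V" using G by (auto simp: simple_graph_def)
  then have finE: "finite E" using finite_subset by blast
  then have h: "0 < h" using \<open>E \<noteq> {}\<close> by (simp add: h_def card_gt_0_iff)
  obtain en where en: "bij_betw en {..<h} E"
    using ex_bij_betw_nat_finite[OF finE] by (auto simp: h_def atLeast0LessThan)
  obtain n where n: "V \<subseteq> {..<n}"
    using \<open>finite V\<close> finite_nat_bounded by blast
  have "\<exists>a b. a < b \<and> b < n \<and> en i = {a, b}" if "i < h" for i
  proof -
    have "en i \<in> E" using en that by (auto simp: bij_betw_def)
    then have ei: "en i \<subseteq> V" "card (en i) = 2" using G by (auto simp: simple_graph_def)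
    then obtain a b where "en i = {a, b}" "a \<noteq> b" by (meson card_2_iff)
    then have "a < n" "b < n" "a < b \<or> b < a" using ei n by auto
    then show ?thesis using \<open>en i = {a, b}\<close> insert_commute by metis
  qed
  then obtain u w where uw: "\<And>i. i < h \<Longrightarrow> u i < w i \<and> w i < n \<and> en i = {u i, w i}" by metis
  have bij: "bij_betw (\<lambda>i. {u i, w i}) {..<h} E"
    using en uw by (subst bij_betw_cong[of _ _ en]) auto
  \<comment> \<open>Cap \<open>k\<close> belongs to edge \<open>k div 2\<close>, at its end
    \<open>u\<close> for even \<open>k\<close> and \<open>w\<close> for odd \<open>k\<close>; this
    is its slot number in the layout of \<open>handle_graph\<close>.\<close>
  define sl where "sl k = (if even k then u (k div 2) else w (k div 2)) * Suc h + Suc (k div 2)" for k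
  define \<theta> where "\<theta> k = pi * real (sl k) / real (n * Suc h)" for k
  define p where "p k = equator_point (\<theta> k)" for k
  have sl_less: "sl k < n * Suc h" if "k < 2 * h" for k
  proof -
    let ?v = "if even k then u (k div 2) else w (k div 2)"
    have "k div 2 < h" using that by simp
    then have "?v < n" "k div 2 < h" using uw[of "k div 2"] by auto
    then have "sl k < Suc ?v * Suc h" "Suc ?v \<le> n" by (auto simp: sl_def)
    then show ?thesis by (meson mult_le_mono1 order_less_le_trans)
  qed
  have \<theta>_range: "\<theta> k \<in> {0..<pi}" if "k < 2 * h" for k
  proof -
    have "real (sl k) < real (n * Suc h)" using sl_less[OF that] by (simp only: of_nat_less_iff)
    then show ?thesis unfolding \<theta>_def by (simp add: divide_less_eq del: mult_Suc_right of_nat_mult)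
  qed
  have "inj_on p {..<2 * h}"
  proof (rule inj_onI)
    fix k l assume kl: "k \<in> {..<2 * h}" "l \<in> {..<2 * h}" "p k = p l"
    then have "p k $ 1 = p l $ 1" by simp
    then have "cos (\<theta> k) = cos (\<theta> l)"
      by (simp add: p_def equator_point_def axis_def)
    then have "\<theta> k = \<theta> l"
      using \<theta>_range[of k] \<theta>_range[of l] kl cos_inj_pi[of "\<theta> k" "\<theta> l"] by auto
    moreover have "0 < n * Suc h" using sl_less[of k] kl by (metis less_nat_zero_code lessThan_iff neq0_conv)
    ultimately have sl: "sl k = sl l" unfolding \<theta>_def
      by (auto simp: divide_cancel_right simp del: of_nat_mult mult_Suc_right)
    have d: "k div 2 < Suc h" "l div 2 < Suc h" "k div 2 < h" using kl by auto
    \<comment> \<open>Since \<open>Suc (k div 2) \<le> h\<close>, the remainder modulo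
      \<open>Suc h\<close> recovers the edge; the vertex then tells the parity, as \<open>u\<close>
      and \<open>w\<close> differ.\<close>
    have "sl k mod Suc h = Suc (k div 2) mod Suc h" "sl l mod Suc h = Suc (l div 2) mod Suc h"
      unfolding sl_def by (simp_all only: mod_mult_self3)
    then have kd: "k div 2 = l div 2" using sl kl by simp
    moreover have "even k \<longleftrightarrow> even l"
    proof -
      have "(if even k then u (k div 2) else w (k div 2)) = (if even l then u (k div 2) else w (k div 2))"
        using sl unfolding sl_def kd by (simp only: add_right_cancel mult_cancel2) auto
      then show ?thesis using uw[OF d(3)] by (auto split: if_splits)
    qed
    ultimately show "k = l" by (metis even_two_times_div_two odd_two_times_div_two_succ)
  qed
  then obtain c0 where c0: "0 \<le> c0" "c0 < 1"
    "\<And>i j x. \<lbrakk>i < 2 * h; j < 2 * h; i \<noteq> j; norm x = 1; c0 \<le> p i \<bullet> x\<rbrakk> \<Longrightarrow> p j \<bullet> x < c0"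
    using exists_disjoint_caps[of "2 * h" p] by (auto simp: p_def norm_equator_point)
  interpret handle_graph h p c0 \<theta> n u w
  proof
    show "\<theta> (2 * i) = pi * real (u i * Suc h + Suc i) / real (n * Suc h)"
      "\<theta> (Suc (2 * i)) = pi * real (w i * Suc h + Suc i) / real (n * Suc h)" for i
      by (simp_all add: \<theta>_def sl_def del: mult_Suc_right)
  qed (use h c0 uw \<theta>_range in \<open>auto simp: p_def norm_equator_point\<close>)
  \<comment> \<open>\<open>glue\<close> takes values in \<open>real^3\<close>, so \<open>X\<close>
    has the type required by \<open>embeddable_with_euler_genus\<close>.\<close>
  obtain X where q: "quotient_map (top_of_set Y) X glue"
    by (rule quotient_topology_exists)
  have "surface X" "sphere_with_handles h X"
    using quotient_is_surface[OF connected_Y Y_nonempty q] by auto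
  moreover have "embeds_in V E X" using embeds[OF q n bij] .
  ultimately show ?thesis
    unfolding embeddable_with_euler_genus_def has_euler_genus_def h_def[symmetric] by blast
qed

section \<open>The graphs\<close>

definition adj7 :: "nat \<Rightarrow> nat \<Rightarrow> bool" where
  "adj7 j k \<longleftrightarrow> j < 7 \<and> k < 7 \<and> (k = Suc j \<or> j = Suc k \<or> j = 6 \<and> k = 0 \<or> j = 0 \<and> k = 6)"

lemma adj7_sym: "adj7 j k \<longleftrightarrow> adj7 k j"
  by (auto simp: adj7_def)

lemma adj7_irrefl: "\<not> adj7 k k"
  by (auto simp: adj7_def)

text \<open>A closed walk of odd length must go around the 7-cycle, so it has at least 7 steps; one
  of length 4 must backtrack, which the two inequalities exclude.\<close>

lemma no_short_cycle_adj7: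
  "adj7 a b \<Longrightarrow> adj7 b c \<Longrightarrow> adj7 c a \<Longrightarrow> False"
  "adj7 a b \<Longrightarrow> adj7 b c \<Longrightarrow> adj7 c d \<Longrightarrow> adj7 d a \<Longrightarrow> a \<noteq> c \<Longrightarrow> b \<noteq> d \<Longrightarrow> False"
  "adj7 a b \<Longrightarrow> adj7 b c \<Longrightarrow> adj7 c d \<Longrightarrow> adj7 d e \<Longrightarrow> adj7 e a \<Longrightarrow> False"
  unfolding adj7_def by linarith+

text \<open>With colours 0 and 1 only, the colours would alternate along the path from 0 to 6 and
  give its ends the same colour, though they are adjacent.\<close>

lemma adj7_not_2_colourable:
  fixes col :: "nat \<Rightarrow> nat"
  assumes "\<And>k. k < 7 \<Longrightarrow> col k < 3"
    and "\<And>j k. \<lbrakk>adj7 j k; col j \<noteq> 2\<rbrakk> \<Longrightarrow> col k \<noteq> col j"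
  obtains k where "k < 7" "col k = 2"
proof (rule ccontr)
  note found = that
  assume "\<not> thesis"
  then have ne: "col k \<noteq> 2" if "k < 7" for k using found[of k] that by blast
  have bit: "col k = 0 \<or> col k = 1" if "k < 7" for k
    using assms(1)[OF that] ne[OF that] by linarith
  have diff: "col k \<noteq> col j" if "adj7 j k" for j k
    using assms(2)[OF that] ne[of j] that by (simp add: adj7_def)
  have "adj7 0 1" "adj7 1 2" "adj7 2 3" "adj7 3 4" "adj7 4 5" "adj7 5 6" "adj7 6 0"
    by (auto simp: adj7_def)
  then have ne: "col 1 \<noteq> col 0" "col 2 \<noteq> col 1" "col 3 \<noteq> col 2" "col 4 \<noteq> col 3" "col 5 \<noteq> col 4"
    "col 6 \<noteq> col 5" "col 0 \<noteq> col 6"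
    using diff by blast+
  have alt: "col l = col j" if "j < 7" "k < 7" "l < 7" "col k \<noteq> col j" "col l \<noteq> col k" for j k l
    using bit[of j] bit[of k] bit[of l] that by auto
  have "col 2 = col 0" "col 4 = col 2" "col 6 = col 4"
    using alt[of 0 1 2] alt[of 2 3 4] alt[of 4 5 6] ne by auto
  then show False using ne by simp
qed

section \<open>Hubs, gadgets and their adjacency\<close>

text \<open>\<open>Hub i j\<close> is the \<open>j\<close>-th vertex of the \<open>i\<close>-th hub cycle, and \<open>Gad s m k\<close> the \<open>k\<close>-th vertex
  of the \<open>m\<close>-th gadget cycle attached to the selection \<open>s\<close> of one vertex from each hub cycle.\<close>

datatype vertex = Hub nat nat | Gad "nat list" nat nat

instance vertex :: countable
  by countable_datatype

definition selections :: "nat list set" where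
  "selections = {s. set s \<subseteq> {..<7} \<and> length s = 7}"

text \<open>Position \<open>k\<close> of each gadget is joined to hub cycle \<open>k\<close>, so
  adjacent gadget vertices go to different hub cycles; this prevents short cycles.\<close>

fun adj :: "nat \<Rightarrow> vertex \<Rightarrow> vertex \<Rightarrow> bool" where
  "adj N (Hub i j) (Hub i' j') \<longleftrightarrow> i = i' \<and> i < 7 \<and> adj7 j j'"
| "adj N (Hub i j) (Gad s m k) \<longleftrightarrow> s \<in> selections \<and> m < N \<and> k < 7 \<and> i = k \<and> j = s ! k"
| "adj N (Gad s m k) (Hub i j) \<longleftrightarrow> s \<in> selections \<and> m < N \<and> k < 7 \<and> i = k \<and> j = s ! k"
| "adj N (Gad s m k) (Gad s' m' k') \<longleftrightarrow> s = s' \<and> m = m' \<and> s \<in> selections \<and> m < N \<and> adj7 k k'"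

lemma adj_sym: "adj N x y \<longleftrightarrow> adj N y x"
  by (cases x; cases y) (auto simp: adj7_sym)

lemma adj_irrefl: "\<not> adj N x x"
  by (cases x) (auto simp: adj7_irrefl)

text \<open>In this and the next two lemmas, a cycle inside one hub or gadget cycle falls to
  \<open>no_short_cycle_adj7\<close>, a mixed one to a comparison of hub indices with gadget
  positions.\<close>

lemma no_triangle: "\<lbrakk>adj N a b; adj N b c; adj N c a\<rbrakk> \<Longrightarrow> False"
  by (cases a; cases b; cases c) (auto simp: adj7_irrefl dest: no_short_cycle_adj7(1))

lemma no_4_cycle:
  "\<lbrakk>adj N a b; adj N b c; adj N c d; adj N d a; a \<noteq> c; b \<noteq> d\<rbrakk> \<Longrightarrow> False"
  by (cases a; cases b; cases c; cases d)
    (auto simp: adj7_irrefl dest: no_short_cycle_adj7(2))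

lemma no_5_cycle:
  "\<lbrakk>adj N a b; adj N b c; adj N c d; adj N d e; adj N e a; distinct [a, b, c, d, e]\<rbrakk> \<Longrightarrow> False"
  by (cases a; cases b; cases c; cases d; cases e)
    (auto simp: adj7_irrefl dest: no_short_cycle_adj7(3))

definition verts :: "nat \<Rightarrow> vertex set" where
  "verts N = {Hub i j | i j. i < 7 \<and> j < 7} \<union> {Gad s m k | s m k. s \<in> selections \<and> m < N \<and> k < 7}"

text \<open>Vertices are encoded by natural numbers because the theorem asks for a
  \<open>nat set\<close>.\<close>

definition V_graph :: "nat \<Rightarrow> nat set" where
  "V_graph N = to_nat ` verts N"

definition E_graph :: "nat \<Rightarrow> nat set set" where
  "E_graph N = {{to_nat x, to_nat y} | x y. adj N x y}"

lemma nth_selection: "s \<in> selections \<Longrightarrow> k < 7 \<Longrightarrow> s ! k < 7"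
  unfolding selections_def by (metis (mono_tags, lifting) lessThan_iff mem_Collect_eq nth_mem subsetD)

lemma adj_verts: "adj N x y \<Longrightarrow> x \<in> verts N"
  by (cases x; cases y) (auto simp: verts_def adj7_def nth_selection)

lemma finite_selections: "finite selections"
  unfolding selections_def by (rule finite_lists_length_eq) simp

lemma finite_verts: "finite (verts N)"
proof -
  have "verts N \<subseteq> case_prod Hub ` ({..<7} \<times> {..<7})
      \<union> (\<lambda>(s, m, k). Gad s m k) ` (selections \<times> {..<N} \<times> {..<7})"
    by (auto simp: verts_def image_iff)
  then show ?thesis using finite_selections finite_subset by blast
qed

lemma mem_E_graph: "{to_nat x, to_nat y} \<in> E_graph N \<longleftrightarrow> adj N x y" for x y :: vertex
  unfolding E_graph_def using adj_sym by (auto simp: doubleton_eq_iff)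

lemma E_graph_from_nat:
  assumes "{a, b} \<in> E_graph N"
  obtains x y :: vertex where "a = to_nat x" "b = to_nat y" "adj N x y"
proof -
  obtain x y :: vertex where "{a, b} = {to_nat x, to_nat y}" "adj N x y"
    using assms by (auto simp: E_graph_def)
  then show thesis using that adj_sym by (metis doubleton_eq_iff)
qed

lemma simple_graph_VE: "simple_graph (V_graph N) (E_graph N)"
  unfolding simple_graph_def
proof (intro conjI ballI)
  fix e assume "e \<in> E_graph N"
  then obtain x y :: vertex where e: "e = {to_nat x, to_nat y}" "adj N x y"
    by (auto simp: E_graph_def)
  then show "e \<subseteq> V_graph N" using adj_verts[of N x y] adj_verts[of N y x] adj_sym[of N x y]
    by (auto simp: V_graph_def)
  have "to_nat x \<noteq> to_nat y" using e adj_irrefl by auto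
  then show "card e = 2" using e by simp
qed (simp add: V_graph_def finite_verts)

section \<open>The girth\<close>

lemma cycle_length:
  assumes "is_cycle (E_graph N) vs"
  shows "6 \<le> length vs"
proof (rule ccontr)
  assume "\<not> 6 \<le> length vs"
  moreover have len: "3 \<le> length vs" and dist: "distinct vs"
    and edge: "\<And>i. i < length vs \<Longrightarrow> {vs ! i, vs ! (Suc i mod length vs)} \<in> E_graph N"
    using assms by (auto simp: is_cycle_def)
  ultimately have lens: "length vs = 3 \<or> length vs = 4 \<or> length vs = 5" by linarith
  define us :: "vertex list" where "us = map from_nat vs"
  have to_us: "vs ! i = to_nat (us ! i)" if "i < length vs" for i
    using edge[OF that] that by (metis E_graph_from_nat us_def nth_map from_nat_to_nat)
  have adj: "adj N (us ! i) (us ! j)" if "i < length vs" "j = Suc i mod length vs" for i j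
  proof -
    have "Suc i mod length vs < length vs" using that(1) by (intro mod_less_divisor) auto
    then show ?thesis using edge[OF that(1)] to_us that mem_E_graph by metis
  qed
  have ne: "us ! i \<noteq> us ! j" if "i < length vs" "j < length vs" "i \<noteq> j" for i j
    using that dist to_us by (metis nth_eq_iff_index_eq)
  from lens show False
  proof (elim disjE)
    assume len: "length vs = 3"
    have "adj N (us ! 0) (us ! 1)" "adj N (us ! 1) (us ! 2)" "adj N (us ! 2) (us ! 0)"
      by (rule adj; simp add: len)+
    then show False
      using no_triangle[of N "us ! 0" "us ! 1" "us ! 2"]  by blast
  next
    assume len: "length vs = 4"
    have "adj N (us ! 0) (us ! 1)" "adj N (us ! 1) (us ! 2)" "adj N (us ! 2) (us ! 3)" "adj N (us ! 3) (us ! 0)"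
      by (rule adj; simp add: len)+
    then show False
      using no_4_cycle[of N "us ! 0" "us ! 1" "us ! 2" "us ! 3"] ne[of 0 2] ne[of 1 3] len by simp
  next
    assume len: "length vs = 5"
    have dist5: "distinct [us ! 0, us ! 1, us ! 2, us ! 3, us ! 4]"
      using ne len by simp
    have "adj N (us ! 0) (us ! 1)" "adj N (us ! 1) (us ! 2)" "adj N (us ! 2) (us ! 3)" "adj N (us ! 3) (us ! 4)" "adj N (us ! 4) (us ! 0)"
      by (rule adj; simp add: len)+
    then show False
      using no_5_cycle[of N "us ! 0" "us ! 1" "us ! 2" "us ! 3" "us ! 4"] dist5 by blast
  qed
qed

lemma girth_E_graph:
  assumes "2 \<le> N"
  shows "girth (E_graph N) = 6"
proof (rule antisym)
  define s where "s = replicate 7 (0 :: nat)"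
  have s: "s \<in> selections" "s ! 0 = 0" "s ! 1 = 0" by (auto simp: s_def selections_def)
  \<comment> \<open>A hexagon through the gadgets 0 and 1 of one selection, between hub cycles 0 and
    1; two gadgets exist because \<open>2 \<le> N\<close>.\<close>
  define us where "us = [Hub 0 0, Gad s 0 0, Gad s 0 1, Hub 1 0, Gad s 1 1, Gad s 1 0]"
  have "is_cycle (E_graph N) (map to_nat us)"
    unfolding is_cycle_def
  proof (intro conjI allI impI)
    show "3 \<le> length (map to_nat us)" "distinct (map to_nat us)"
      by (auto simp: us_def)
    fix i assume "i < length (map to_nat us)"
    then have i: "i < 6" by (simp add: us_def)
    then consider "i = 0" | "i = 1" | "i = 2" | "i = 3" | "i = 4" | "i = 5" by linarith
    then have "adj N (us ! i) (us ! (Suc i mod 6))"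
      using s assms by cases (auto simp: us_def adj7_def)
    moreover have "Suc i mod 6 < 6" "length us = 6" by (auto simp: us_def)
    ultimately show "{map to_nat us ! i, map to_nat us ! (Suc i mod length (map to_nat us))} \<in> E_graph N"
      using i by (simp add: mem_E_graph)
  qed
  then have "girth (E_graph N) \<le> enat (length (map to_nat us))"
    unfolding girth_def by (intro INF_lower) simp
  then show "girth (E_graph N) \<le> 6"
    by (simp add: us_def numeral_eq_enat eval_nat_numeral)
  show "6 \<le> girth (E_graph N)"
    unfolding girth_def using cycle_length by (auto intro!: INF_greatest simp: numeral_eq_enat)
qed

section \<open>The number of edges\<close>

text \<open>Only linearity in \<open>N\<close> matters, so ordered pairs are counted:
  \<open>7 * 7 * 7 = 343\<close> for the hub cycles, and for each gadget 49 on its cycle and 7 to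
  hubs. The factor \<open>N\<close> absorbs the constant 343.\<close>

lemma card_E_graph_le:
  assumes "1 \<le> N"
  shows "card (E_graph N) \<le> (343 + 56 * card selections) * N"
proof -
  let ?e = "\<lambda>(x :: vertex, y). {to_nat x, to_nat y}"
  let ?A = "(\<lambda>(i, j, j'). (Hub i j, Hub i j')) ` ({..<7} \<times> {..<7} \<times> {..<7})"
  let ?B = "(\<lambda>(s, m, k, k'). (Gad s m k, Gad s m k')) ` (selections \<times> {..<N} \<times> {..<7} \<times> {..<7})"
  let ?C = "(\<lambda>(s, m, k). (Gad s m k, Hub k (s ! k))) ` (selections \<times> {..<N} \<times> {..<7})"
  have fin: "finite ?A" "finite ?B" "finite ?C" using finite_selections by auto
  have "E_graph N \<subseteq> ?e ` (?A \<union> ?B \<union> ?C)"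
  proof
    fix e assume "e \<in> E_graph N"
    then obtain x y where e: "e = {to_nat x, to_nat y}" "adj N x y"
      by (auto simp: E_graph_def)
    have "(x, y) \<in> ?A \<union> ?B \<union> ?C \<or> (y, x) \<in> ?A \<union> ?B \<union> ?C"
      using e(2) by (cases x; cases y) (auto simp: adj7_def image_iff)
    then show "e \<in> ?e ` (?A \<union> ?B \<union> ?C)"
      using e(1) by (metis (mono_tags, lifting) case_prod_conv image_eqI insert_commute)
  qed
  then have "card (E_graph N) \<le> card (?e ` (?A \<union> ?B \<union> ?C))"
    using fin by (intro card_mono finite_imageI) auto
  also have "\<dots> \<le> card (?A \<union> ?B \<union> ?C)"
    using fin by (intro card_image_le) auto
  also have "\<dots> \<le> card ?A + card ?B + card ?C"
    using card_Un_le by (meson add_le_mono1 le_trans)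
  also have "\<dots> \<le> 343 + card selections * N * 49 + card selections * N * 7"
  proof (intro add_mono)
    show "card ?A \<le> 343"
      by (rule order_trans[OF card_image_le]) (auto simp: card_cartesian_product)
    show "card ?B \<le> card selections * N * 49"
      by (rule order_trans[OF card_image_le])
        (auto simp: card_cartesian_product finite_selections)
    show "card ?C \<le> card selections * N * 7"
      by (rule order_trans[OF card_image_le])
        (auto simp: card_cartesian_product finite_selections)
  qed
  also have "\<dots> \<le> (343 + 56 * card selections) * N"
    using assms by (simp add: algebra_simps)
  finally show ?thesis .
qed

text \<open>This makes the genera unbounded and the edge set nonempty.\<close>

lemma le_card_E_graph: "N \<le> card (E_graph N)"
proof -
  define s where "s = replicate 7 (0 :: nat)"
  have s: "s \<in> selections" "s ! 0 = 0" by (auto simp: s_def selections_def)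
  let ?f = "\<lambda>m. {to_nat (Gad s m 0), to_nat (Hub 0 0)}"
  have "inj_on ?f {..<N}" by (auto simp: inj_on_def doubleton_eq_iff)
  moreover have "?f ` {..<N} \<subseteq> E_graph N" using s by (auto simp: mem_E_graph)
  moreover have "finite (E_graph N)"
    using simple_graph_VE[of N] finite_subset[of "E_graph N" "Pow (V_graph N)"]
    by (auto simp: simple_graph_def)
  ultimately have "card {..<N} \<le> card (E_graph N)" by (rule card_inj_on_le)
  then show ?thesis by simp
qed

section \<open>The lower bound for the defect\<close>

lemma colourable_imp_le:
  assumes "defective_colorable (V_graph N) (E_graph N) [0, 0, d]"
  shows "int N \<le> 7 * d"
proof -
  obtain col :: "nat \<Rightarrow> nat" where c: "\<forall>v\<in>V_graph N. col v < length [0, 0, d] \<and>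
      int (card {u \<in> V_graph N. {u, v} \<in> E_graph N \<and> col u = col v}) \<le> [0, 0, d] ! col v"
    using assms unfolding defective_colorable_def by blast
  have col: "\<And>v. v \<in> V_graph N \<Longrightarrow> col v < 3"
    "\<And>v. v \<in> V_graph N \<Longrightarrow>
      int (card {u \<in> V_graph N. {u, v} \<in> E_graph N \<and> col u = col v}) \<le> [0, 0, d] ! col v"
    using c by (simp_all add: numeral_3_eq_3)
  define f where "f x = col (to_nat x)" for x :: vertex
  have f_less: "f x < 3" if "x \<in> verts N" for x
    using col(1) that by (simp add: f_def V_graph_def)
  have finV: "finite (V_graph N)" by (simp add: V_graph_def finite_verts)
  \<comment> \<open>Colours 0 and 1 have defect 0, so a vertex of such a colour has no neighbour of
    the same colour.\<close>
  have proper: "f y \<noteq> f x" if "adj N x y" "f x \<noteq> 2" for x y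
  proof
    assume eq: "f y = f x"
    have xy: "x \<in> verts N" "y \<in> verts N" using that adj_verts adj_sym by blast+
    have "f x = 0 \<or> f x = 1" using f_less[OF xy(1)] that by linarith
    then have "[0, 0, d] ! f x = 0" by auto
    then have "card {u \<in> V_graph N. {u, to_nat x} \<in> E_graph N \<and> col u = col (to_nat x)} = 0"
      using col(2)[of "to_nat x"] xy by (simp add: f_def V_graph_def)
    then have "{u \<in> V_graph N. {u, to_nat x} \<in> E_graph N \<and> col u = col (to_nat x)} = {}"
      using finV by simp
    moreover have "to_nat y \<in> {u \<in> V_graph N. {u, to_nat x} \<in> E_graph N \<and> col u = col (to_nat x)}"
      using xy eq that adj_sym by (simp add: V_graph_def f_def mem_E_graph)
    ultimately show False by blast
  qed
  have "\<exists>j<7. f (Hub i j) = 2" if "i < 7" for i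
  proof -
    obtain j where "j < 7" "f (Hub i j) = 2"
    proof (rule adj7_not_2_colourable)
      show "f (Hub i k) < 3" if "k < 7" for k
        using f_less \<open>i < 7\<close> that by (simp add: verts_def)
      show "f (Hub i k) \<noteq> f (Hub i j)" if "adj7 j k" "f (Hub i j) \<noteq> 2" for j k
        using proper \<open>i < 7\<close> that by simp
    qed
    then show ?thesis by blast
  qed
  then obtain j where j: "\<And>i. i < 7 \<Longrightarrow> j i < 7 \<and> f (Hub i (j i)) = 2" by metis
  \<comment> \<open>The selection whose seven hubs all have colour 2; only its \<open>N\<close>
    gadgets are examined.\<close>
  define s where "s = map j [0..<7]"
  have s: "s \<in> selections" "\<And>k. k < 7 \<Longrightarrow> s ! k = j k"
    using j by (auto simp: s_def selections_def)
  \<comment> \<open>\<open>B k\<close> collects the gadgets with colour 2 at position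
    \<open>k\<close>. Every gadget is in one of these seven sets, so their sizes add up to at least
    \<open>N\<close>.\<close>
  define B where "B k = {m. m < N \<and> f (Gad s m k) = 2}" for k
  have "{..<N} \<subseteq> (\<Union>k<7. B k)"
  proof
    fix m assume "m \<in> {..<N}"
    then have m: "m < N" by simp
    obtain k where "k < 7" "f (Gad s m k) = 2"
    proof (rule adj7_not_2_colourable)
      show "f (Gad s m k) < 3" if "k < 7" for k
        using f_less s m that by (simp add: verts_def)
      show "f (Gad s m k) \<noteq> f (Gad s m j)" if "adj7 j k" "f (Gad s m j) \<noteq> 2" for j k
        using proper s m that by simp
    qed
    then show "m \<in> (\<Union>k<7. B k)" using m by (auto simp: B_def)
  qed
  moreover have "finite (\<Union>k<7. B k)" by (auto simp: B_def)
  ultimately have "N \<le> card (\<Union>k<7. B k)" using card_mono[of "\<Union>k<7. B k" "{..<N}"] by simp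
  also have "\<dots> \<le> (\<Sum>k<7. card (B k))" by (rule card_UN_le) simp
  finally have "int N \<le> (\<Sum>k<7. int (card (B k)))" by (simp flip: of_nat_sum)
  also have "\<dots> \<le> (\<Sum>k<7::nat. d)"
  proof (rule sum_mono)
    fix k :: nat assume "k \<in> {..<7}"
    then have k: "k < 7" by simp
    let ?x = "Hub k (s ! k)"
    have x: "?x \<in> verts N" "f ?x = 2" using k j s by (auto simp: verts_def)
    let ?W = "{u \<in> V_graph N. {u, to_nat ?x} \<in> E_graph N \<and> col u = col (to_nat ?x)}"
    \<comment> \<open>The vertices counted by \<open>B k\<close> are neighbours of the hub
      \<open>?x\<close> and share its colour 2, so its defect bound limits their number.\<close>
    have "(\<lambda>m. to_nat (Gad s m k)) ` B k \<subseteq> ?W"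
      using k s x by (auto simp: B_def V_graph_def mem_E_graph verts_def f_def)
    moreover have "inj_on (\<lambda>m. to_nat (Gad s m k)) (B k)" by (auto simp: inj_on_def)
    ultimately have "card (B k) \<le> card ?W"
      using finV by (intro card_inj_on_le) auto
    also have "int (card ?W) \<le> d"
      using col(2)[of "to_nat ?x"] x by (simp add: V_graph_def f_def)
    finally show "int (card (B k)) \<le> d" by simp
  qed
  finally show ?thesis by simp
qed

section \<open>The choice of the constants\<close>

theorem mainTheorem11:
  "\<exists>\<epsilon>::real. \<epsilon> > 0 \<and>
     infinite {g::nat. g > 0 \<and>
       (\<exists>(V :: nat set) (E :: nat set set).
          simple_graph V E \<and> girth E = 6 \<and> embeddable_with_euler_genus V E g \<and>
          \<not> defective_colorable V E [0, 0, \<lceil>\<epsilon> * real g\<rceil>])}"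
proof -
  define C where "C = 343 + 56 * card selections"
  \<comment> \<open>From \<open>g \<le> 2 * C * N\<close> follows
    \<open>\<epsilon> * g \<le> N / 28\<close>, so seven times the rounded-up defect is less than
    \<open>N / 4 + 7\<close>.\<close>
  define \<epsilon> where "\<epsilon> = 1 / (56 * real C)"
  have C: "0 < real C" by (simp add: C_def)
  then have "\<epsilon> > 0" by (simp add: \<epsilon>_def)
  moreover have "\<exists>g\<ge>m. g > 0 \<and> (\<exists>(V :: nat set) (E :: nat set set).
          simple_graph V E \<and> girth E = 6 \<and> embeddable_with_euler_genus V E g \<and>
          \<not> defective_colorable V E [0, 0, \<lceil>\<epsilon> * real g\<rceil>])" for m
  proof -
    \<comment> \<open>\<open>10 \<le> N\<close> gives \<open>N / 4 + 7 < N\<close>, which absorbs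
      the rounding, and \<open>m \<le> N \<le> g\<close> makes the genus arbitrarily large.\<close>
    define N where "N = max 10 m"
    define g where "g = 2 * card (E_graph N)"
    have N: "10 \<le> N" "m \<le> N" by (auto simp: N_def)
    have "N \<le> g" using le_card_E_graph[of N] by (simp add: g_def)
    have "card (E_graph N) \<le> C * N" using card_E_graph_le N by (simp add: C_def)
    then have "real (card (E_graph N)) \<le> real C * real N" by (metis of_nat_le_iff of_nat_mult)
    then have "real g \<le> 2 * (real C * real N)" by (simp add: g_def)
    then have "\<epsilon> * real g \<le> \<epsilon> * (2 * (real C * real N))"
      using \<open>\<epsilon> > 0\<close> by (intro mult_left_mono) auto
    also have "\<dots> = real N / 28" using C by (simp add: \<epsilon>_def)
    finally have "7 * (\<epsilon> * real g + 1) < real N" using N by simp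
    moreover have "real_of_int \<lceil>\<epsilon> * real g\<rceil> < \<epsilon> * real g + 1" by linarith
    ultimately have "real_of_int (7 * \<lceil>\<epsilon> * real g\<rceil>) < real_of_int (int N)" by simp
    then have "7 * \<lceil>\<epsilon> * real g\<rceil> < int N" by (simp only: of_int_less_iff)
    then have "\<not> defective_colorable (V_graph N) (E_graph N) [0, 0, \<lceil>\<epsilon> * real g\<rceil>]"
      using colourable_imp_le[of N] by fastforce
    moreover have "E_graph N \<noteq> {}" using le_card_E_graph[of N] N by auto
    then have "embeddable_with_euler_genus (V_graph N) (E_graph N) g"
      unfolding g_def by (intro embeddable_with_handle_per_edge simple_graph_VE)
    moreover have "girth (E_graph N) = 6" using N by (intro girth_E_graph) simp
    ultimately show ?thesis
      using simple_graph_VE \<open>N \<le> g\<close> N by (intro exI[of _ g]) auto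
  qed
  ultimately show ?thesis
    unfolding infinite_nat_iff_unbounded_le by blast
qed

end
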